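(* Let $(V,\{r_{\{x,y\}};x,y\in V\})$ be a weighted discrete tree with a fixed root $\rho\in V$ such that for every direction $x=(x_n)_{n\in\mathbb{N}_0}$, $\sum_{n}r_{\{x_n,x_{n+1}\}}=\infty$. Let $X$ be the random walk on $(V,\{r_{\{x,y\}};x,y\in V\})$. Then $X$ is recurrent if the $1$-dimensional Hausdorff measure $\mathcal{H}^1$ on $(\tilde E_\infty,\mathcal{B}(\tilde E_\infty))$ is a finite measure, and $X$ is transient if the Hausdorff dimension satisfies $\dim_{\mathrm{H}}(\tilde E_\infty,\tilde r)>1$.
   Context: A weighted discrete tree consists of a non-empty countable set $V$ and non-negative weights $\{r_{\{x,y\}};x,y\in V\}$ such that, with edge set $E:=\{\{x,y\}:x,y\in V,\ r_{\{x,y\}}>0\}$, the graph $(V,E)$ is a locally finite graph-theoretical tree. The random walk $X=(X_n)_{n\in\mathbb{N}_0}$ is the Markov chain on $V$ that moves from $x$ to a neighbour $y$ (i.e. $r_{\{x,y\}}>0$) with probability proportional to the conductance $c_{\{x,y\}}:=(r_{\{x,y\}})^{-1}$. Let $r(x,y)$ denote the sum of the weights $r_e$ over the edges $e$ of the self-avoiding path from $x$ to $y$ in $V$. A direction is an infinite sequence $(x_n)_{n\in\mathbb{N}_0}$ of distinct vertices with $x_0=\rho$ and $r_{\{x_n,x_{n+1}\}}>0$ for all $n$; $\tilde E_\infty$ is the set of all directions. For directions $x,y$ let $k(x,y)$ be the last index $k$ (possibly $\infty$) with $x_k=y_k$; $x\wedge y:=x_{k(x,y)}$ if $k(x,y)<\infty$,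 and $x\wedge y:=x\in\tilde E_\infty$ if $k(x,y)=\infty$. The metric on $\tilde E_\infty$ is $\tilde r(x,y):=(r(x\wedge y,\rho))^{-1}\wedge1$ (with $\tilde r(x,x)=0$ and $0^{-1}:=\infty$). Hausdorff measure and dimension are taken with respect to $\tilde r$: $\mathcal{H}^\alpha(A)=\lim_{\varepsilon\downarrow0}\inf\{\sum_{i\ge1}(\mathrm{diam}\,E_i)^\alpha:\bigcup_iE_i\supseteq A,\ \mathrm{diam}\,E_i\le\varepsilon\}$, $\dim_{\mathrm{H}}(A)=\inf\{\alpha\ge0:\mathcal{H}^\alpha(A)=0\}$. *)

theory Defs
  imports "HOL-Probability.Probability"
begin

text \<open>
  A weight function takes the unordered pair \<open>{x, y}\<close> as its argument, so symmetry is built in.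
  Only its values at \<open>{x, y}\<close> with \<open>x, y \<in> V\<close> matter.
\<close>

definition adj :: "'v set \<Rightarrow> ('v set \<Rightarrow> real) \<Rightarrow> 'v \<Rightarrow> 'v \<Rightarrow> bool" where
  "adj V r x y \<longleftrightarrow> x \<in> V \<and> y \<in> V \<and> r {x, y} > 0"

definition self_avoiding_path ::
    "'v set \<Rightarrow> ('v set \<Rightarrow> real) \<Rightarrow> 'v \<Rightarrow> 'v list \<Rightarrow> 'v \<Rightarrow> bool" where
  "self_avoiding_path V r x p y \<longleftrightarrow>
     p \<noteq> [] \<and> set p \<subseteq> V \<and> distinct p \<and> hd p = x \<and> last p = y \<and> successively (adj V r) p"

text \<open>
  A graph-theoretical tree is a simple graph in which any two vertices are joined by
  exactly one self-avoiding path. Self-avoiding paths do not see loops, hence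
  \<open>no_loops\<close> is a separate condition (note that \<open>{x, x} = {x}\<close>).
\<close>

locale weighted_discrete_tree =
  fixes V :: "'v set" and r :: "'v set \<Rightarrow> real"
  assumes nonempty: "V \<noteq> {}"
    and countable: "countable V"
    and nonneg: "\<And>x y. x \<in> V \<Longrightarrow> y \<in> V \<Longrightarrow> r {x, y} \<ge> 0"
    and no_loops: "\<And>x. \<not> adj V r x x"
    and locally_finite: "\<And>x. x \<in> V \<Longrightarrow> finite {y. adj V r x y}"
    and unique_path: "\<And>x y. x \<in> V \<Longrightarrow> y \<in> V \<Longrightarrow> \<exists>!p. self_avoiding_path V r x p y"

definition tree_dist :: "'v set \<Rightarrow> ('v set \<Rightarrow> real) \<Rightarrow> 'v \<Rightarrow> 'v \<Rightarrow> real" where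
  "tree_dist V r x y =
     (let p = (THE p. self_avoiding_path V r x p y)
      in \<Sum>i<length p - 1. r {p ! i, p ! Suc i})"

definition conductance :: "('v set \<Rightarrow> real) \<Rightarrow> 'v \<Rightarrow> 'v \<Rightarrow> real" where
  "conductance r x y = inverse (r {x, y})"

text \<open>
  A vertex without neighbours occurs only in the tree with a single vertex; there the walk stays put.
\<close>

definition transition_prob :: "'v set \<Rightarrow> ('v set \<Rightarrow> real) \<Rightarrow> 'v \<Rightarrow> 'v \<Rightarrow> real" where
  "transition_prob V r x y =
     (if \<exists>z. adj V r x z
      then (if adj V r x y then conductance r x y / (\<Sum>z\<in>{z. adj V r x z}. conductance r x z) else 0)
      else (if y = x then 1 else 0))"

definition markov_chain_from ::
    "'v set \<Rightarrow> ('v \<Rightarrow> 'v \<Rightarrow> real) \<Rightarrow> 'v \<Rightarrow> 'w measure \<Rightarrow> (nat \<Rightarrow> 'w \<Rightarrow> 'v) \<Rightarrow> bool" where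
  "markov_chain_from V p x M X \<longleftrightarrow>
     prob_space M \<and>
     (\<forall>n. X n \<in> measurable M (count_space V)) \<and>
     (AE \<omega> in M. X 0 \<omega> = x) \<and>
     (\<forall>n a. \<forall>y\<in>V. \<P>(\<omega> in M. \<forall>i\<le>n. X i \<omega> = a i) > 0 \<longrightarrow>
        \<P>(\<omega> in M. X (Suc n) \<omega> = y \<bar> \<forall>i\<le>n. X i \<omega> = a i) = p (a n) y)"

text \<open>\<open>P x\<close> is the law under which the walk \<open>X\<close> starts in \<open>x\<close>.\<close>

definition random_walk ::
    "'v set \<Rightarrow> ('v set \<Rightarrow> real) \<Rightarrow> ('v \<Rightarrow> 'w measure) \<Rightarrow> (nat \<Rightarrow> 'w \<Rightarrow> 'v) \<Rightarrow> bool" where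
  "random_walk V r P X \<longleftrightarrow> (\<forall>x\<in>V. markov_chain_from V (transition_prob V r) x (P x) X)"

definition recurrent :: "'v set \<Rightarrow> ('v \<Rightarrow> 'w measure) \<Rightarrow> (nat \<Rightarrow> 'w \<Rightarrow> 'v) \<Rightarrow> bool" where
  "recurrent V P X \<longleftrightarrow> (\<forall>x\<in>V. \<P>(\<omega> in P x. \<exists>n\<ge>1. X n \<omega> = x) = 1)"

definition transient :: "'v set \<Rightarrow> ('v \<Rightarrow> 'w measure) \<Rightarrow> (nat \<Rightarrow> 'w \<Rightarrow> 'v) \<Rightarrow> bool" where
  "transient V P X \<longleftrightarrow> (\<forall>x\<in>V. \<P>(\<omega> in P x. \<exists>n\<ge>1. X n \<omega> = x) < 1)"

definition directions :: "'v set \<Rightarrow> ('v set \<Rightarrow> real) \<Rightarrow> 'v \<Rightarrow> (nat \<Rightarrow> 'v) set" where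
  "directions V r \<rho> = {x. x 0 = \<rho> \<and> inj x \<and> (\<forall>n. adj V r (x n) (x (Suc n)))}"

definition branch_index :: "(nat \<Rightarrow> 'v) \<Rightarrow> (nat \<Rightarrow> 'v) \<Rightarrow> enat" where
  "branch_index x y = Sup {enat k | k. x k = y k}"

text \<open>
  Since \<open>1 / 0 = 0\<close> in HOL, the convention that the inverse of \<open>0\<close> is \<open>\<infinity>\<close> has to be written out.
\<close>

definition dir_dist ::
    "'v set \<Rightarrow> ('v set \<Rightarrow> real) \<Rightarrow> 'v \<Rightarrow> (nat \<Rightarrow> 'v) \<Rightarrow> (nat \<Rightarrow> 'v) \<Rightarrow> real" where
  "dir_dist V r \<rho> x y =
     (case branch_index x y of
        \<infinity> \<Rightarrow> 0
      | enat k \<Rightarrow>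
          (let h = tree_dist V r (x k) \<rho> in if h = 0 then 1 else min (inverse h) 1))"

definition diam :: "('a \<Rightarrow> 'a \<Rightarrow> real) \<Rightarrow> 'a set \<Rightarrow> ennreal" where
  "diam d S = (SUP x\<in>S. SUP y\<in>S. ennreal (d x y))"

text \<open>
  The \<open>\<alpha>\<close>-th power of the diameter, with the usual conventions for \<open>\<alpha> = 0\<close>: the empty set
  contributes \<open>0\<close> and every non-empty set contributes \<open>1\<close> (whereas \<open>0 powr 0 = 0\<close> in HOL).
  It is only applied to sets of finite diameter.
\<close>

definition diam_power :: "('a \<Rightarrow> 'a \<Rightarrow> real) \<Rightarrow> real \<Rightarrow> 'a set \<Rightarrow> ennreal" where
  "diam_power d \<alpha> S =
     (if S = {} then 0 else if \<alpha> = 0 then 1 else ennreal (enn2real (diam d S) powr \<alpha>))"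

text \<open>\<open>S\<close> is the ambient space, from which the covering sets are taken.\<close>

definition hausdorff_content ::
    "'a set \<Rightarrow> ('a \<Rightarrow> 'a \<Rightarrow> real) \<Rightarrow> real \<Rightarrow> 'a set \<Rightarrow> real \<Rightarrow> ennreal" where
  "hausdorff_content S d \<alpha> A \<epsilon> =
     (INF E\<in>{E :: nat \<Rightarrow> 'a set. (\<forall>i. E i \<subseteq> S \<and> diam d (E i) \<le> ennreal \<epsilon>) \<and> A \<subseteq> (\<Union>i. E i)}.
        \<Sum>i. diam_power d \<alpha> (E i))"

definition hausdorff_measure ::
    "'a set \<Rightarrow> ('a \<Rightarrow> 'a \<Rightarrow> real) \<Rightarrow> real \<Rightarrow> 'a set \<Rightarrow> ennreal" where
  "hausdorff_measure S d \<alpha> A = Lim (at_right 0) (hausdorff_content S d \<alpha> A)"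

definition hausdorff_dim :: "'a set \<Rightarrow> ('a \<Rightarrow> 'a \<Rightarrow> real) \<Rightarrow> 'a set \<Rightarrow> ennreal" where
  "hausdorff_dim S d A = (INF \<alpha>\<in>{\<alpha> :: real. 0 \<le> \<alpha> \<and> hausdorff_measure S d \<alpha> A = 0}. ennreal \<alpha>)"

text \<open>The limit in the definition of the Hausdorff measure exists, by monotonicity.\<close>

lemma hausdorff_content_antimono:
  assumes "\<epsilon> \<le> \<delta>"
  shows "hausdorff_content S d \<alpha> A \<delta> \<le> hausdorff_content S d \<alpha> A \<epsilon>"
  unfolding hausdorff_content_def
  by (rule INF_superset_mono) (use assms in \<open>auto intro: order_trans ennreal_leI\<close>)

lemma hausdorff_content_tendsto:
  "(hausdorff_content S d \<alpha> A \<longlongrightarrow> (SUP \<epsilon>\<in>{0<..}. hausdorff_content S d \<alpha> A \<epsilon>)) (at_right 0)"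
proof (rule increasing_tendsto)
  show "\<forall>\<^sub>F \<epsilon> in at_right 0. hausdorff_content S d \<alpha> A \<epsilon> \<le> (SUP \<epsilon>\<in>{0<..}. hausdorff_content S d \<alpha> A \<epsilon>)"
    using eventually_at_right_less[of "0::real"]
    by eventually_elim (auto intro!: SUP_upper)
next
  fix c assume "c < (SUP \<epsilon>\<in>{0<..}. hausdorff_content S d \<alpha> A \<epsilon>)"
  then obtain \<delta> where \<delta>: "\<delta> > 0" "c < hausdorff_content S d \<alpha> A \<delta>"
    by (auto simp: less_SUP_iff)
  have "\<forall>\<^sub>F \<epsilon> in at_right 0. \<epsilon> < \<delta>"
    using \<delta>(1) by (auto simp: eventually_at_right_field)
  then show "\<forall>\<^sub>F \<epsilon> in at_right 0. c < hausdorff_content S d \<alpha> A \<epsilon>"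
    by eventually_elim (meson \<delta>(2) hausdorff_content_antimono less_imp_le less_le_trans)
qed

lemma hausdorff_measure_eq_SUP:
  "hausdorff_measure S d \<alpha> A = (SUP \<epsilon>\<in>{0<..}. hausdorff_content S d \<alpha> A \<epsilon>)"
  unfolding hausdorff_measure_def
  by (rule tendsto_Lim[OF _ hausdorff_content_tendsto]) simp

end

theory Submission
  imports Defs
begin

text \<open>
  Recurrence. A finite \<open>1\<close>-dimensional measure gives, for every \<open>s\<close>, a cutset \<open>W\<close> beyond height \<open>2 s\<close>
  with \<open>\<Sum>w\<in>W. 1 / ht w\<close> bounded independently of \<open>s\<close>. It carries a function that is \<open>1\<close> up to
  height \<open>s\<close>, vanishes beyond \<open>W\<close>, and has bounded Dirichlet energy. Averaging \<open>K\<close> such functions with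
  disjointly supported gradients makes the energy \<open>O(1 / K)\<close>, and by Picone's inequality a walk that
  fails to return with positive probability excludes arbitrarily small energies.

  Transience. For \<open>\<alpha> > 1\<close> with positive \<open>\<alpha>\<close>-dimensional measure, the Hausdorff content of the set of
  directions through \<open>v\<close> is a subadditive flow bounded by a multiple of \<open>(1 + ht v) powr - \<alpha>\<close>.
  Its potential is a non-constant bounded subharmonic function.
\<close>

section \<open>Hitting probabilities of Markov chains with finite range\<close>

text \<open>The walk enters only through \<open>hit_lim\<close>; both halves then become statements
  about superharmonic functions on the tree.

  Recurrence: covering sets need not be cylinders and may have diameter 0, which corresponds to no
  vertex. Each one is therefore assigned a slightly larger size, with summable excesses, and
  replaced by a vertex that all its directions pass. The resulting cutset may be infinite; Konig's
  lemma extracts a finite one, so the cut functions have finite support and all energies are finite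
  sums.

  Transience: the content plays the part of a Frostman measure. It is merely subadditive: the
  children of a vertex carry at least as much as the vertex itself. This is exactly the inequality
  that makes the potential subharmonic. Content at scale 1 replaces the measure because the measure
  may be infinite, while the content is finite and vanishes only if the measure does.\<close>

fun hit :: "('v \<Rightarrow> 'v set) \<Rightarrow> ('v \<Rightarrow> 'v \<Rightarrow> real) \<Rightarrow> 'v \<Rightarrow> nat \<Rightarrow> 'v \<Rightarrow> real" where
  "hit N p b 0 v = 0"
| "hit N p b (Suc n) v = (\<Sum>z\<in>N v. p v z * (if z = b then 1 else hit N p b n z))"

text \<open>The recursion of \<open>hit\<close> tests the successor, never the starting point, so
  only visits at times 1, ..., n count and \<open>hit_lim N p b b\<close> is a return
  probability.\<close>

definition hit_lim :: "('v \<Rightarrow> 'v set) \<Rightarrow> ('v \<Rightarrow> 'v \<Rightarrow> real) \<Rightarrow> 'v \<Rightarrow> 'v \<Rightarrow> real" where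
  "hit_lim N p b v = (SUP n. hit N p b n v)"

text \<open>\<open>N v\<close> is the support of row \<open>v\<close>. Its finiteness lets limits
  pass through expectations; strict positivity feeds the maximum principle.\<close>

locale finite_range_kernel =
  fixes V :: "'v set" and N :: "'v \<Rightarrow> 'v set" and p :: "'v \<Rightarrow> 'v \<Rightarrow> real"
  assumes finite_N: "v \<in> V \<Longrightarrow> finite (N v)"
    and N_subset: "v \<in> V \<Longrightarrow> N v \<subseteq> V"
    and p_pos: "v \<in> V \<Longrightarrow> z \<in> N v \<Longrightarrow> p v z > 0"
    and p_sum: "v \<in> V \<Longrightarrow> (\<Sum>z\<in>N v. p v z) = 1"
begin

lemma average_le:
  assumes "v \<in> V" "\<And>z. z \<in> N v \<Longrightarrow> f z \<le> m"
  shows "(\<Sum>z\<in>N v. p v z * f z) \<le> m"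
proof -
  have "(\<Sum>z\<in>N v. p v z * f z) \<le> (\<Sum>z\<in>N v. p v z * m)"
    using assms p_pos by (intro sum_mono mult_left_mono) (auto intro: less_imp_le)
  also have "\<dots> = m" using p_sum[OF assms(1)] by (simp flip: sum_distrib_right)
  finally show ?thesis .
qed

text \<open>Maximum principle: the deficits \<open>m - f z\<close> are nonnegative with weighted sum
  at most 0, and the weights are positive.\<close>

lemma average_attains_bound:
  assumes "v \<in> V" and le: "\<And>z. z \<in> N v \<Longrightarrow> f z \<le> m"
    and ge: "m \<le> (\<Sum>z\<in>N v. p v z * f z)" and z: "z \<in> N v"
  shows "f z = m"
proof -
  have "(\<Sum>z\<in>N v. p v z * (m - f z)) = m - (\<Sum>z\<in>N v. p v z * f z)"
    using p_sum[OF assms(1)]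
    by (simp add: right_diff_distrib sum_subtractf flip: sum_distrib_right)
  also have "\<dots> \<le> 0" using ge by simp
  finally have s: "(\<Sum>z\<in>N v. p v z * (m - f z)) \<le> 0" .
  have nn: "\<And>z. z \<in> N v \<Longrightarrow> 0 \<le> p v z * (m - f z)"
    using le p_pos[OF assms(1)] by (simp add: less_imp_le)
  have "(\<Sum>z\<in>N v. p v z * (m - f z)) = 0"
    using s sum_nonneg[of "N v" "\<lambda>z. p v z * (m - f z)"] nn by force
  then have "p v z * (m - f z) = 0"
    using sum_nonneg_eq_0_iff[OF finite_N[OF assms(1)], of "\<lambda>z. p v z * (m - f z)"] nn z by auto
  then show ?thesis using p_pos[OF assms(1) z] by simp
qed

lemma hit_nonneg: "v \<in> V \<Longrightarrow> 0 \<le> hit N p b n v"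
proof (induction n arbitrary: v)
  case (Suc n)
  have "0 \<le> p v z * (if z = b then 1 else hit N p b n z)" if "z \<in> N v" for z
    using Suc that p_pos[of v z] N_subset[of v] by (auto simp: less_imp_le)
  then show ?case by (simp add: sum_nonneg)
qed simp

lemma hit_le_1: "v \<in> V \<Longrightarrow> hit N p b n v \<le> 1"
proof (induction n arbitrary: v)
  case (Suc n)
  then have "(\<Sum>z\<in>N v. p v z * (if z = b then 1 else hit N p b n z)) \<le> 1"
    using N_subset[of v] by (intro average_le) auto
  then show ?case by simp
qed simp

lemma hit_Suc_mono: "v \<in> V \<Longrightarrow> hit N p b n v \<le> hit N p b (Suc n) v"
proof (induction n arbitrary: v)
  case 0
  then show ?case using hit_nonneg[of v b "Suc 0"] by simp
next
  case (Suc n)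
  have "(\<Sum>z\<in>N v. p v z * (if z = b then 1 else hit N p b n z))
      \<le> (\<Sum>z\<in>N v. p v z * (if z = b then 1 else hit N p b (Suc n) z))"
    using Suc p_pos[of v] N_subset[of v]
    by (intro sum_mono mult_left_mono) (auto simp: less_imp_le simp del: hit.simps)
  then show ?case by (metis hit.simps(2))
qed

lemma hit_tendsto:
  assumes "v \<in> V"
  shows "(\<lambda>n. hit N p b n v) \<longlonglongrightarrow> hit_lim N p b v"
  unfolding hit_lim_def
proof (rule LIMSEQ_incseq_SUP)
  show "bdd_above (range (\<lambda>n. hit N p b n v))"
    using hit_le_1[OF assms] by (auto simp: bdd_above_def)
  show "incseq (\<lambda>n. hit N p b n v)"
    using hit_Suc_mono[OF assms] by (rule incseq_SucI)
qed

lemma hit_lim_nonneg: "v \<in> V \<Longrightarrow> 0 \<le> hit_lim N p b v"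
  using hit_nonneg by (intro LIMSEQ_le_const[OF hit_tendsto]) auto

lemma hit_lim_le_1: "v \<in> V \<Longrightarrow> hit_lim N p b v \<le> 1"
  using hit_le_1 by (intro LIMSEQ_le_const2[OF hit_tendsto]) auto

lemma hit_lim_eq:
  assumes "v \<in> V"
  shows "hit_lim N p b v = (\<Sum>z\<in>N v. p v z * (if z = b then 1 else hit_lim N p b z))"
proof -
  have *: "(\<lambda>n. if z = b then 1 else hit N p b n z) \<longlonglongrightarrow> (if z = b then 1 else hit_lim N p b z)"
    if "z \<in> N v" for z
    using hit_tendsto[of z b] that N_subset[OF assms] by auto
  have "(\<lambda>n. hit N p b (Suc n) v) \<longlonglongrightarrow> (\<Sum>z\<in>N v. p v z * (if z = b then 1 else hit_lim N p b z))"
    unfolding hit.simps by (intro tendsto_sum tendsto_mult tendsto_const *)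
  with LIMSEQ_Suc[OF hit_tendsto[OF assms, of b]] show ?thesis
    by (rule LIMSEQ_unique)
qed

text \<open>A finite-horizon form of optional stopping: superharmonicity carries the bound from
  \<open>n\<close> to \<open>Suc n\<close>, and the limit inherits it.\<close>

lemma superharmonic_ge_hit_lim:
  assumes u: "\<And>v. v \<in> V \<Longrightarrow> 0 \<le> u v" "\<And>v. v \<in> V \<Longrightarrow> (\<Sum>z\<in>N v. p v z * u z) \<le> u v"
    and "b \<in> V" "v \<in> V"
  shows "u b * hit_lim N p b v \<le> u v"
proof -
  have "u b * hit N p b n v \<le> u v" for n
    using \<open>v \<in> V\<close>
  proof (induction n arbitrary: v)
    case 0
    then show ?case using u(1) by simp
  next
    case (Suc n)
    have "u b * hit N p b (Suc n) v = (\<Sum>z\<in>N v. p v z * (u b * (if z = b then 1 else hit N p b n z)))"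
      by (simp add: sum_distrib_left mult.left_commute)
    also have "\<dots> \<le> (\<Sum>z\<in>N v. p v z * u z)"
      using Suc N_subset[of v] p_pos[of v]
      by (intro sum_mono mult_left_mono) (auto simp: less_imp_le)
    also have "\<dots> \<le> u v" using u(2) Suc by blast
    finally show ?case .
  qed
  moreover have "(\<lambda>n. u b * hit N p b n v) \<longlonglongrightarrow> u b * hit_lim N p b v"
    by (intro tendsto_mult tendsto_const hit_tendsto assms)
  ultimately show ?thesis by (intro LIMSEQ_le_const2) auto
qed

text \<open>\<open>conn\<close> is irreducibility, stated through closed sets. By the maximum
  principle the points from which \<open>b\<close> is hit almost surely form a closed set; hence
  \<open>u b\<close> is the minimum of \<open>u\<close>, and the set where it is attained is closed
  too.\<close>

lemma superharmonic_constant_if_recurrent: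
  assumes conn: "\<And>S. S \<subseteq> V \<Longrightarrow> b \<in> S \<Longrightarrow> (\<And>v. v \<in> S \<Longrightarrow> N v \<subseteq> S) \<Longrightarrow> S = V"
    and rec: "hit_lim N p b b = 1" and b: "b \<in> V"
    and u: "\<And>v. v \<in> V \<Longrightarrow> 0 \<le> u v" "\<And>v. v \<in> V \<Longrightarrow> (\<Sum>z\<in>N v. p v z * u z) \<le> u v"
    and v: "v \<in> V"
  shows "u v = u b"
proof -
  have "{v \<in> V. hit_lim N p b v = 1} = V"
  proof (rule conn)
    fix v assume "v \<in> {v \<in> V. hit_lim N p b v = 1}"
    then have v: "v \<in> V" "hit_lim N p b v = 1" by auto
    show "N v \<subseteq> {v \<in> V. hit_lim N p b v = 1}"
    proof
      fix z assume z: "z \<in> N v"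
      have "(if z = b then 1 else hit_lim N p b z) = 1"
        using v hit_lim_eq[OF v(1), of b] z N_subset[OF v(1)]
        by (intro average_attains_bound[of v "\<lambda>z. if z = b then 1 else hit_lim N p b z"])
          (auto intro: hit_lim_le_1)
      \<comment> \<open>For \<open>z = b\<close> the averaged function is 1 by definition and says
        nothing about \<open>hit_lim\<close> at \<open>b\<close>; \<open>rec\<close> supplies that
        value.\<close>
      then show "z \<in> {v \<in> V. hit_lim N p b v = 1}"
        using rec z N_subset[OF v(1)] by (auto split: if_splits)
    qed
  qed (use rec b in auto)
  then have "hit_lim N p b v = 1" if "v \<in> V" for v
    using that by blast
  then have min: "u b \<le> u v" if "v \<in> V" for v
    using superharmonic_ge_hit_lim[OF u b that] that by simp
  have "{v \<in> V. u v = u b} = V"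
  proof (rule conn)
    fix v assume "v \<in> {v \<in> V. u v = u b}"
    then have v: "v \<in> V" "u v = u b" by auto
    show "N v \<subseteq> {v \<in> V. u v = u b}"
    proof
      fix z assume z: "z \<in> N v"
      have "- u z = - u b"
        using v u(2)[OF v(1)] z N_subset[OF v(1)] min
        by (intro average_attains_bound[of v "\<lambda>z. - u z"]) (auto simp: sum_negf)
      then show "z \<in> {v \<in> V. u v = u b}"
        using z N_subset[OF v(1)] by auto
    qed
  qed (use b in auto)
  then show ?thesis using v by auto
qed

text \<open>\<open>markov_chain_from\<close> prescribes one-step probabilities given a whole initial
  segment. The induction therefore runs over all prefixes \<open>a\<close> up to time
  \<open>m\<close> and moves the window of visits along, instead of restarting the chain.\<close>

lemma return_probability_eq_hit_lim:
  assumes mc: "markov_chain_from V p x M X" and x: "x \<in> V"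
  shows "\<P>(\<omega> in M. \<exists>n\<ge>1. X n \<omega> = b) = hit_lim N p b x"
proof -
  interpret prob_space M using mc by (simp add: markov_chain_from_def)
  have X[measurable]: "X n \<in> measurable M (count_space V)" for n
    using mc by (simp add: markov_chain_from_def)
  have X0: "AE \<omega> in M. X 0 \<omega> = x"
    using mc by (simp add: markov_chain_from_def)
  have step: "\<P>(\<omega> in M. X (Suc n) \<omega> = y \<bar> \<forall>i\<le>n. X i \<omega> = a i) = p (a n) y"
    if "y \<in> V" "\<P>(\<omega> in M. \<forall>i\<le>n. X i \<omega> = a i) > 0" for n a y
    using mc that by (simp add: markov_chain_from_def)
  have XV: "X n \<omega> \<in> V" if "\<omega> \<in> space M" for n \<omega>
    using measurable_space[OF X that] by simp
  have eqm[measurable]: "Measurable.pred M (\<lambda>\<omega>. X n \<omega> = c)" for n c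
  proof -
    have "{\<omega> \<in> space M. X n \<omega> = c} = X n -` ({c} \<inter> V) \<inter> space M" using XV by auto
    also have "\<dots> \<in> sets M" by (rule measurable_sets[OF X]) auto
    finally show ?thesis by (simp add: pred_def)
  qed
  define C where "C a m = {\<omega> \<in> space M. \<forall>i\<le>m. X i \<omega> = a i}" for a and m :: nat
  define H where "H m n = {\<omega> \<in> space M. \<exists>k. m < k \<and> k \<le> m + n \<and> X k \<omega> = b}" for m n :: nat
  have Cm[measurable]: "C a m \<in> sets M" for a m unfolding C_def by measurable
  have Hm[measurable]: "H m n \<in> sets M" for m n unfolding H_def by measurable
  have main: "measure M (C a m \<inter> H m n) = measure M (C a m) * hit N p b n (a m)" for a m n
  proof (induction n arbitrary: a m)
    case 0
    have "H m 0 = {}" by (auto simp: H_def)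
    then show ?case by simp
  next
    case (Suc n)
    show ?case
    proof (cases "measure M (C a m) = 0")
      \<comment> \<open>On null prefixes the chain condition is silent, but both sides
        vanish.\<close>
      case True
      have "measure M (C a m \<inter> H m (Suc n)) \<le> measure M (C a m)"
        by (intro finite_measure_mono) auto
      with True show ?thesis by (simp add: measure_le_0_iff)
    next
      case False
      then have pos: "measure M (C a m) > 0" by (simp add: zero_less_measure_iff)
      then have "C a m \<noteq> {}" by auto
      then obtain \<omega> where "\<omega> \<in> C a m" by blast
      then have am: "a m \<in> V" using XV[of \<omega> m] by (auto simp: C_def)
      define A where "A z = C (a(Suc m := z)) (Suc m)" for z
      have A_eq: "A z = {\<omega> \<in> space M. X (Suc m) \<omega> = z \<and> (\<forall>i\<le>m. X i \<omega> = a i)}" for z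
        by (auto simp: A_def C_def le_Suc_eq)
      have mA: "measure M (A z) = measure M (C a m) * p (a m) z" if "z \<in> N (a m)" for z
        using step[of z m a] that N_subset[OF am] pos
        unfolding cond_prob_def A_eq C_def by (auto simp: field_simps)
      have Am[measurable]: "A z \<in> sets M" for z unfolding A_def by measurable
      have AC: "A z \<subseteq> C a m" for z by (auto simp: A_eq C_def)
      have disj: "disjoint_family_on A (N (a m))"
        by (auto simp: disjoint_family_on_def A_eq)
      let ?U = "\<Union>z\<in>N (a m). A z"
      have fin: "finite (N (a m))" using finite_N am by blast
      have "measure M ?U = (\<Sum>z\<in>N (a m). measure M (A z))"
        using fin disj by (intro finite_measure_finite_Union) auto
      also have "\<dots> = measure M (C a m)"
        using mA p_sum[OF am] by (simp flip: sum_distrib_left)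
      finally have mU: "measure M ?U = measure M (C a m)" .
      have Um[measurable]: "?U \<in> sets M" using fin by (intro sets.finite_UN) auto
      \<comment> \<open>The row of \<open>a m\<close> has total mass 1 on \<open>N (a m)\<close>, so
        all other moves are null.\<close>
      have "measure M (C a m - ?U) = 0"
        using mU AC by (subst finite_measure_Diff) auto
      moreover have "measure M ((C a m \<inter> H m (Suc n)) - ?U) \<le> measure M (C a m - ?U)"
        by (intro finite_measure_mono) auto
      ultimately have z0: "measure M ((C a m \<inter> H m (Suc n)) - ?U) = 0"
        by (simp add: measure_le_0_iff)
      have "measure M (C a m \<inter> H m (Suc n)) = measure M (C a m \<inter> H m (Suc n) \<inter> ?U)"
      proof -
        have "measure M (C a m \<inter> H m (Suc n))
            = measure M (((C a m \<inter> H m (Suc n)) - ?U) \<union> (C a m \<inter> H m (Suc n) \<inter> ?U))"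
          by (rule arg_cong[of _ _ "measure M"]) auto
        also have "\<dots> = measure M ((C a m \<inter> H m (Suc n)) - ?U) + measure M (C a m \<inter> H m (Suc n) \<inter> ?U)"
          by (intro finite_measure_Union) auto
        finally show ?thesis using z0 by simp
      qed
      also have "C a m \<inter> H m (Suc n) \<inter> ?U = (\<Union>z\<in>N (a m). A z \<inter> H m (Suc n))"
        using AC by auto
      also have "measure M \<dots> = (\<Sum>z\<in>N (a m). measure M (A z \<inter> H m (Suc n)))"
        using fin disj by (intro finite_measure_finite_Union) (auto simp: disjoint_family_on_def)
      also have "\<dots> = (\<Sum>z\<in>N (a m). measure M (C a m) * (p (a m) z * (if z = b then 1 else hit N p b n z)))"
      proof (intro sum.cong refl)
        fix z assume z: "z \<in> N (a m)"
        show "measure M (A z \<inter> H m (Suc n))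
            = measure M (C a m) * (p (a m) z * (if z = b then 1 else hit N p b n z))"
        proof (cases "z = b")
          case True
          then have "A z \<inter> H m (Suc n) = A z"
            by (auto simp: A_eq H_def intro!: exI[of _ "Suc m"])
          then show ?thesis using True mA[OF z] by simp
        next
          case False
          \<comment> \<open>Time \<open>m + 1\<close> is no visit, so the window loses its first
            instant.\<close>
          then have "A z \<inter> H m (Suc n) = A z \<inter> H (Suc m) n"
            by (auto simp: A_eq H_def) (metis Suc_lessI Suc_lessD)+
          then show ?thesis using False mA[OF z] Suc.IH[of "a(Suc m := z)" "Suc m"]
            by (simp add: A_def fun_upd_same del: fun_upd_apply)
        qed
      qed
      also have "\<dots> = measure M (C a m) * hit N p b (Suc n) (a m)"
        by (simp add: sum_distrib_left)
      finally show ?thesis .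
    qed
  qed
  have C0: "AE \<omega> in M. \<omega> \<in> C (\<lambda>_. x) 0"
    using X0 AE_space by eventually_elim (auto simp: C_def)
  then have "measure M (C (\<lambda>_. x) 0) = 1" by (subst prob_eq_1) auto
  moreover have "measure M (C (\<lambda>_. x) 0 \<inter> H 0 n) = measure M (H 0 n)" for n
    using C0 by (intro finite_measure_eq_AE) auto
  ultimately have "measure M (H 0 n) = hit N p b n x" for n
    using main[of "\<lambda>_. x" 0 n] by simp
  moreover have "(\<lambda>n. measure M (H 0 n)) \<longlonglongrightarrow> measure M (\<Union>n. H 0 n)"
    by (intro finite_Lim_measure_incseq) (auto simp: incseq_def H_def)
  moreover have "(\<Union>n. H 0 n) = {\<omega> \<in> space M. \<exists>n\<ge>1. X n \<omega> = b}"
    by (auto simp: H_def Suc_le_eq)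
  ultimately show ?thesis
    using LIMSEQ_unique[OF hit_tendsto[OF x, of b]] by simp
qed

end

section \<open>Hausdorff content\<close>

lemma hausdorff_content_le_suminf:
  assumes "\<And>i. E i \<subseteq> S" "\<And>i. diam d (E i) \<le> ennreal \<epsilon>" "A \<subseteq> (\<Union>i. E i)"
  shows "hausdorff_content S d \<alpha> A \<epsilon> \<le> (\<Sum>i. diam_power d \<alpha> (E i))"
  unfolding hausdorff_content_def using assms by (intro INF_lower) auto

lemma hausdorff_content_lessE:
  assumes "hausdorff_content S d \<alpha> A \<epsilon> < c"
  obtains E where "\<And>i. E i \<subseteq> S" "\<And>i. diam d (E i) \<le> ennreal \<epsilon>" "A \<subseteq> (\<Union>i. E i)"
    "(\<Sum>i. diam_power d \<alpha> (E i)) < c"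
  using assms unfolding hausdorff_content_def INF_less_iff by blast

lemma diam_empty [simp]: "diam d {} = 0"
  by (simp add: diam_def bot_ennreal)

lemma hausdorff_content_le_diam_power:
  assumes "A \<subseteq> S" "diam d A \<le> ennreal \<epsilon>"
  shows "hausdorff_content S d \<alpha> A \<epsilon> \<le> diam_power d \<alpha> A"
proof -
  let ?E = "\<lambda>i::nat. if i = 0 then A else {}"
  have "hausdorff_content S d \<alpha> A \<epsilon> \<le> (\<Sum>i. diam_power d \<alpha> (?E i))"
    using assms by (intro hausdorff_content_le_suminf) (auto intro!: exI[of _ 0] split: if_splits)
  also have "\<dots> = (\<Sum>i\<in>{0}. diam_power d \<alpha> (?E i))"
    by (rule suminf_finite) (auto simp: diam_power_def)
  finally show ?thesis by simp
qed

lemma hausdorff_content_empty [simp]: "hausdorff_content S d \<alpha> {} \<epsilon> = 0"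
  using hausdorff_content_le_diam_power[of "{}" S d \<epsilon> \<alpha>] by (simp add: diam_power_def)

lemma hausdorff_content_mono:
  "A \<subseteq> B \<Longrightarrow> hausdorff_content S d \<alpha> A \<epsilon> \<le> hausdorff_content S d \<alpha> B \<epsilon>"
  unfolding hausdorff_content_def by (rule INF_superset_mono) auto

text \<open>A cover is a single sequence, so two covers are merged by placing them on the even and
  the odd indices.\<close>

lemma suminf_interleave_le:
  fixes f g :: "nat \<Rightarrow> ennreal"
  shows "(\<Sum>i. if even i then f (i div 2) else g (i div 2)) \<le> suminf f + suminf g"
proof (rule suminf_le_const)
  let ?h = "\<lambda>i. if even i then f (i div 2) else g (i div 2)"
  fix n
  have "sum ?h {..<2 * m} = sum f {..<m} + sum g {..<m}" for m
    by (induction m) (auto simp: algebra_simps)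
  moreover have "sum ?h {..<n} \<le> sum ?h {..<2 * n}" by (intro sum_mono2) auto
  ultimately show "sum ?h {..<n} \<le> suminf f + suminf g"
    by (auto intro!: add_mono sum_le_suminf elim!: order_trans)
qed simp

lemma hausdorff_content_Un:
  "hausdorff_content S d \<alpha> (A \<union> B) \<epsilon> \<le> hausdorff_content S d \<alpha> A \<epsilon> + hausdorff_content S d \<alpha> B \<epsilon>"
    (is "_ \<le> ?a + ?b")
proof (rule ennreal_le_epsilon)
  fix e :: real assume top: "?a + ?b < top" and e: "0 < e"
  \<comment> \<open>Both contents are finite by \<open>top\<close>, so adding \<open>e / 2\<close>
    increases them strictly and near-optimal covers exist.\<close>
  have "?a + 0 < ?a + ennreal (e / 2)" "?b + 0 < ?b + ennreal (e / 2)"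
    using top e by (auto simp: ennreal_add_left_cancel_less simp del: add_0_right)
  then have a: "?a < ?a + ennreal (e / 2)" and b: "?b < ?b + ennreal (e / 2)" by simp_all
  obtain E where E: "\<And>i. E i \<subseteq> S" "\<And>i. diam d (E i) \<le> ennreal \<epsilon>" "A \<subseteq> (\<Union>i. E i)"
      "(\<Sum>i. diam_power d \<alpha> (E i)) < ?a + ennreal (e / 2)"
    by (rule hausdorff_content_lessE[OF a]) blast
  obtain F where F: "\<And>i. F i \<subseteq> S" "\<And>i. diam d (F i) \<le> ennreal \<epsilon>" "B \<subseteq> (\<Union>i. F i)"
      "(\<Sum>i. diam_power d \<alpha> (F i)) < ?b + ennreal (e / 2)"
    by (rule hausdorff_content_lessE[OF b]) blast
  let ?G = "\<lambda>i. if even i then E (i div 2) else F (i div 2)"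
  have "hausdorff_content S d \<alpha> (A \<union> B) \<epsilon> \<le> (\<Sum>i. diam_power d \<alpha> (?G i))"
  proof (rule hausdorff_content_le_suminf)
    show "A \<union> B \<subseteq> (\<Union>i. ?G i)"
    proof
      fix x assume "x \<in> A \<union> B"
      then consider i where "x \<in> E i" | i where "x \<in> F i" using E(3) F(3) by blast
      then show "x \<in> (\<Union>i. ?G i)"
      proof cases
        case (1 i)
        then show ?thesis by (intro UN_I[of "2 * i"]) auto
      next
        case (2 i)
        then show ?thesis by (intro UN_I[of "2 * i + 1"]) auto
      qed
    qed
  qed (simp_all add: E F)
  also have "\<dots> = (\<Sum>i. if even i then diam_power d \<alpha> (E (i div 2)) else diam_power d \<alpha> (F (i div 2)))"
    by (intro suminf_cong) simp
  also have "\<dots> \<le> (\<Sum>i. diam_power d \<alpha> (E i)) + (\<Sum>i. diam_power d \<alpha> (F i))"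
    by (rule suminf_interleave_le)
  also have "\<dots> \<le> (?a + ennreal (e / 2)) + (?b + ennreal (e / 2))"
    using E(4) F(4) by (intro add_mono) auto
  also have "\<dots> = ?a + ?b + (ennreal (e / 2) + ennreal (e / 2))"
    by (simp add: ac_simps)
  also have "ennreal (e / 2) + ennreal (e / 2) = ennreal e"
    using e by (simp flip: ennreal_plus)
  finally show "hausdorff_content S d \<alpha> (A \<union> B) \<epsilon> \<le> ?a + ?b + ennreal e" .
qed

lemma hausdorff_content_UN:
  assumes "finite I"
  shows "hausdorff_content S d \<alpha> (\<Union>i\<in>I. A i) \<epsilon> \<le> (\<Sum>i\<in>I. hausdorff_content S d \<alpha> (A i) \<epsilon>)"
  using assms
proof induction
  case (insert i I)
  have "hausdorff_content S d \<alpha> (\<Union>i\<in>insert i I. A i) \<epsilon>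
      \<le> hausdorff_content S d \<alpha> (A i) \<epsilon> + hausdorff_content S d \<alpha> (\<Union>i\<in>I. A i) \<epsilon>"
    using hausdorff_content_Un[of S d \<alpha> "A i"] by simp
  also have "\<dots> \<le> hausdorff_content S d \<alpha> (A i) \<epsilon> + (\<Sum>i\<in>I. hausdorff_content S d \<alpha> (A i) \<epsilon>)"
    by (intro add_mono insert order_refl)
  finally show ?case using insert by simp
qed simp

section \<open>From content at one scale to measure and dimension\<close>

lemma diam_finite_eq:
  assumes "diam d E \<le> ennreal \<epsilon>"
  shows "diam d E = ennreal (enn2real (diam d E))"
proof -
  have "diam d E < top" using assms ennreal_less_top by (rule le_less_trans)
  then show ?thesis by simp
qed

text \<open>If the content at one scale vanishes, so does the measure: a cover of small total cost consists
  of sets of small diameter.\<close>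

lemma hausdorff_measure_eq_0_if_content_eq_0:
  assumes "\<alpha> > 0" and zero: "hausdorff_content S d \<alpha> A 1 = 0"
  shows "hausdorff_measure S d \<alpha> A = 0"
proof -
  have "hausdorff_content S d \<alpha> A \<epsilon> \<le> 0 + ennreal \<eta>" if "\<epsilon> > 0" "\<eta> > 0" for \<epsilon> \<eta>
  proof -
    \<comment> \<open>The first bound controls the total cost, the second keeps every single
      diameter below \<open>\<epsilon>\<close>.\<close>
    define c where "c = min \<eta> (\<epsilon> powr \<alpha>)"
    have "c > 0" using that by (simp add: c_def)
    then obtain E where E: "\<And>i. E i \<subseteq> S" "\<And>i. diam d (E i) \<le> ennreal 1" "A \<subseteq> (\<Union>i. E i)"
      "(\<Sum>i. diam_power d \<alpha> (E i)) < ennreal c"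
      using hausdorff_content_lessE[of S d \<alpha> A 1 "ennreal c"] zero by auto
    have "diam d (E i) \<le> ennreal \<epsilon>" for i
    proof (cases "E i = {}")
      case False
      define t where "t = enn2real (diam d (E i))"
      have "diam_power d \<alpha> (E i) \<le> (\<Sum>i. diam_power d \<alpha> (E i))"
        using sum_le_suminf[of "\<lambda>i. diam_power d \<alpha> (E i)" "{i}"] by simp
      also have "\<dots> < ennreal c" by (rule E)
      finally have "ennreal (t powr \<alpha>) < ennreal c"
        using False \<open>\<alpha> > 0\<close> by (simp add: diam_power_def t_def)
      then have "t powr \<alpha> < \<epsilon> powr \<alpha>" by (simp add: ennreal_less_iff c_def)
      then have "t \<le> \<epsilon>"
        using powr_mono2[of \<alpha> \<epsilon> t] that \<open>\<alpha> > 0\<close> by (cases "t \<le> \<epsilon>") auto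
      then show ?thesis
        by (subst diam_finite_eq[OF E(2)[of i]]) (simp add: t_def ennreal_leI)
    qed simp
    then have "hausdorff_content S d \<alpha> A \<epsilon> \<le> (\<Sum>i. diam_power d \<alpha> (E i))"
      using E by (intro hausdorff_content_le_suminf)
    also have "\<dots> \<le> ennreal \<eta>"
      using E(4) by (rule less_imp_le[THEN order_trans]) (simp add: c_def ennreal_leI)
    finally show ?thesis by simp
  qed
  then have "hausdorff_content S d \<alpha> A \<epsilon> \<le> 0" if "\<epsilon> > 0" for \<epsilon>
    by (rule ennreal_le_epsilon) (use that in blast)
  then have "hausdorff_measure S d \<alpha> A \<le> 0"
    unfolding hausdorff_measure_eq_SUP by (intro SUP_least) auto
  then show ?thesis by simp
qed

lemma hausdorff_measure_nonzero_if_less_dim: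
  assumes "hausdorff_dim S d A > ennreal \<beta>" "\<beta> \<ge> 0"
  obtains \<alpha> where "\<alpha> > \<beta>" "hausdorff_measure S d \<alpha> A \<noteq> 0"
proof -
  obtain z where z: "ennreal \<beta> < z" "z < hausdorff_dim S d A" using assms(1) dense by blast
  then obtain \<alpha> where \<alpha>: "z = ennreal \<alpha>" "\<alpha> \<ge> 0"
    by (cases z) (auto simp: top_unique)
  have "hausdorff_measure S d \<alpha> A \<noteq> 0"
  proof
    assume "hausdorff_measure S d \<alpha> A = 0"
    then have "hausdorff_dim S d A \<le> ennreal \<alpha>"
      unfolding hausdorff_dim_def using \<alpha> by (intro INF_lower) auto
    with z \<alpha> show False by simp
  qed
  moreover have "\<alpha> > \<beta>" using z \<alpha> assms(2) by (simp add: ennreal_less_iff)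
  ultimately show thesis by (rule that[rotated])
qed

section \<open>Picone's inequality and a convexity bound\<close>

text \<open>With \<open>a\<^sup>2 / g\<close> as test function, the energy pairing with any positive
  \<open>g\<close> never exceeds the energy of \<open>a\<close>.\<close>

lemma picone:
  fixes a b g h :: real
  assumes "g > 0" "h > 0"
  shows "(g - h) * (a\<^sup>2 / g - b\<^sup>2 / h) \<le> (a - b)\<^sup>2"
proof -
  have "(a - b)\<^sup>2 - (g - h) * (a\<^sup>2 / g - b\<^sup>2 / h) = (a * h - b * g)\<^sup>2 / (g * h)"
    using assms by (simp add: field_simps power2_eq_square)
  also have "\<dots> \<ge> 0" using assms by simp
  finally show ?thesis by simp
qed

text \<open>The left side is a rectangle under the graph of \<open>x powr - \<alpha>\<close> over
  [a, b], the right side the integral, which telescopes along a path.\<close>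

lemma powr_increment_le:
  fixes a b \<alpha> :: real
  assumes "0 < a" "a \<le> b" "1 < \<alpha>"
  shows "(b - a) * b powr (- \<alpha>) \<le> (a powr (1 - \<alpha>) - b powr (1 - \<alpha>)) / (\<alpha> - 1)"
proof (cases "a = b")
  case False
  then have "a < b" using assms by simp
  moreover have "((\<lambda>x. x powr (1 - \<alpha>)) has_real_derivative (1 - \<alpha>) * x powr (- \<alpha>)) (at x)"
    if "a \<le> x" for x
    using that assms by (auto intro!: derivative_eq_intros)
  ultimately obtain z where z: "a < z" "z < b"
      "b powr (1 - \<alpha>) - a powr (1 - \<alpha>) = (b - a) * ((1 - \<alpha>) * z powr (- \<alpha>))"
    using MVT2[of a b "\<lambda>x. x powr (1 - \<alpha>)" "\<lambda>x. (1 - \<alpha>) * x powr (- \<alpha>)"] by blast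
  have "(b - a) * b powr (- \<alpha>) \<le> (b - a) * z powr (- \<alpha>)"
    using z assms by (intro mult_left_mono powr_mono2') auto
  also have "\<dots> = (a powr (1 - \<alpha>) - b powr (1 - \<alpha>)) / (\<alpha> - 1)"
    using z(3) assms by (simp add: field_simps)
  finally show ?thesis .
qed simp

section \<open>Rooted trees\<close>

locale rooted_weighted_tree = weighted_discrete_tree V r
  for V :: "'v set" and r :: "'v set \<Rightarrow> real" +
  fixes \<rho> :: 'v
  assumes root_in_V: "\<rho> \<in> V"
begin

definition pth :: "'v \<Rightarrow> 'v list" where
  "pth v = (THE p. self_avoiding_path V r v p \<rho>)"

definition par :: "'v \<Rightarrow> 'v" where
  "par v = hd (tl (pth v))"

text \<open>At the root \<open>pth\<close> has a single entry and \<open>par\<close> is the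
  unspecified \<open>hd []\<close>; excluding the root keeps it from being a child by
  accident.\<close>

definition ch :: "'v \<Rightarrow> 'v set" where
  "ch v = {w \<in> V. w \<noteq> \<rho> \<and> par w = v}"

text \<open>An edge is represented by its endpoint \<open>w \<noteq> \<rho>\<close> that is farther from the root; \<open>len w\<close>
  is then its weight, and \<open>ed v\<close> is the set of edges of the path from \<open>v\<close> to \<open>\<rho>\<close>.\<close>

definition len :: "'v \<Rightarrow> real" where
  "len w = r {w, par w}"

definition ed :: "'v \<Rightarrow> 'v set" where
  "ed v = set (pth v) - {\<rho>}"

abbreviation ht :: "'v \<Rightarrow> real" where
  "ht v \<equiv> tree_dist V r v \<rho>"

lemma adj_sym: "adj V r v w \<longleftrightarrow> adj V r w v"
  by (auto simp: adj_def insert_commute)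

lemma pth: "v \<in> V \<Longrightarrow> self_avoiding_path V r v (pth v) \<rho>"
  unfolding pth_def by (rule theI') (rule unique_path[OF _ root_in_V])

lemma path_unique:
  assumes "self_avoiding_path V r v p w" "self_avoiding_path V r v q w"
  shows "p = q"
proof -
  have "v \<in> V" "w \<in> V" using assms by (auto simp: self_avoiding_path_def)
  then show ?thesis using unique_path assms by blast
qed

lemma pth_eqI: "self_avoiding_path V r v p \<rho> \<Longrightarrow> pth v = p"
  using path_unique pth by (metis (full_types) hd_in_set self_avoiding_path_def subsetD)

lemma pth_root [simp]: "pth \<rho> = [\<rho>]"
  by (rule pth_eqI) (auto simp: self_avoiding_path_def root_in_V)

lemma pth_par:
  assumes v: "v \<in> V" "v \<noteq> \<rho>"
  shows "par v \<in> V" "adj V r v (par v)" "pth v = v # pth (par v)"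
proof -
  obtain q where q: "pth v = v # q"
    using pth[OF v(1)] by (cases "pth v") (auto simp: self_avoiding_path_def)
  have "q \<noteq> []" using pth[OF v(1)] v(2) q by (auto simp: self_avoiding_path_def)
  then obtain y ys where y: "q = y # ys" by (cases q) auto
  have *: "self_avoiding_path V r y q \<rho>" "adj V r v y" "y \<in> V"
    using pth[OF v(1)] unfolding q y by (auto simp: self_avoiding_path_def)
  have "par v = y" by (simp add: par_def q y)
  then show "par v \<in> V" "adj V r v (par v)" "pth v = v # pth (par v)"
    using * pth_eqI[OF *(1)] q by auto
qed

lemma root_in_pth: "v \<in> V \<Longrightarrow> \<rho> \<in> set (pth v)"
  using pth[of v] by (metis last_in_set self_avoiding_path_def)

lemma self_in_pth: "v \<in> V \<Longrightarrow> v \<in> set (pth v)"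
  using pth[of v] by (metis hd_in_set self_avoiding_path_def)

lemma pth_subset: "v \<in> V \<Longrightarrow> set (pth v) \<subseteq> V"
  using pth[of v] by (simp add: self_avoiding_path_def)

lemma distinct_pth: "v \<in> V \<Longrightarrow> distinct (pth v)"
  using pth[of v] by (simp add: self_avoiding_path_def)

lemma length_pth: "v \<in> V \<Longrightarrow> v \<noteq> \<rho> \<Longrightarrow> length (pth v) = Suc (length (pth (par v)))"
  by (subst pth_par) auto

lemma tree_induct [consumes 1, case_names root step]:
  assumes "v \<in> V" "P \<rho>" "\<And>v. v \<in> V \<Longrightarrow> v \<noteq> \<rho> \<Longrightarrow> par v \<in> V \<Longrightarrow> P (par v) \<Longrightarrow> P v"
  shows "P v"
  using assms(1)
proof (induction "length (pth v)" arbitrary: v rule: less_induct)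
  case less
  show ?case
  proof (cases "v = \<rho>")
    case False
    then show ?thesis
      using less pth_par(1) length_pth[of v] assms(3)[of v] by auto
  qed (simp add: assms)
qed

text \<open>If \<open>w\<close> is off the path from \<open>v\<close> to the root, prepending
  \<open>w\<close> gives the path from \<open>w\<close>, so \<open>v\<close> is its parent.
  Otherwise the initial piece of \<open>pth v\<close> up to \<open>w\<close> and the edge itself are
  two self-avoiding paths, hence equal, and \<open>w\<close> is second on
  \<open>pth v\<close>.\<close>

lemma adj_cases:
  assumes "adj V r v w"
  shows "w \<in> ch v \<or> v \<in> ch w"
proof -
  have vw: "v \<in> V" "w \<in> V" "v \<noteq> w" using assms no_loops by (auto simp: adj_def)
  note p = pth[OF vw(1)]
  show ?thesis
  proof (cases "w \<in> set (pth v)")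
    case False
    obtain q where q: "pth v = v # q"
      using p by (cases "pth v") (auto simp: self_avoiding_path_def)
    have "self_avoiding_path V r w (w # pth v) \<rho>"
      using p False assms vw adj_sym[of v w]
      unfolding q by (auto simp: self_avoiding_path_def)
    then have e: "pth w = w # pth v" by (rule pth_eqI)
    then have "w \<noteq> \<rho>" using q by auto
    moreover have "par w = v" using e by (simp add: par_def q)
    ultimately show ?thesis using vw by (simp add: ch_def)
  next
    case True
    then obtain ys zs where yz: "pth v = ys @ w # zs" by (auto dest: split_list)
    have "ys \<noteq> []" using p vw yz by (auto simp: self_avoiding_path_def)
    moreover have "hd (pth v) = v" using p by (simp add: self_avoiding_path_def)
    ultimately obtain ys' where ys: "ys = v # ys'" using yz
      by (cases ys) auto
    have "successively (adj V r) ((ys @ [w]) @ zs)"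
      using p by (simp add: self_avoiding_path_def yz)
    then have "successively (adj V r) (ys @ [w])"
      by (simp only: successively_append_iff)
    then have "self_avoiding_path V r v (ys @ [w]) w"
      using p by (auto simp: self_avoiding_path_def yz ys)
    moreover have "self_avoiding_path V r v [v, w] w"
      using assms vw by (auto simp: self_avoiding_path_def)
    ultimately have "ys @ [w] = [v, w]" by (rule path_unique)
    then have e: "pth v = v # w # zs" using yz by simp
    then have "v \<noteq> \<rho>" by auto
    then show ?thesis using e vw by (auto simp: ch_def par_def)
  qed
qed

lemma chD: "w \<in> ch v \<Longrightarrow> w \<in> V \<and> w \<noteq> \<rho> \<and> par w = v \<and> v \<in> V \<and> adj V r v w"
  using pth_par adj_sym by (auto simp: ch_def)

lemma adj_iff: "adj V r v w \<longleftrightarrow> w \<in> ch v \<or> v \<in> ch w"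
  using adj_cases chD adj_sym by blast

lemma neighbours:
  assumes "v \<in> V"
  shows "{w. adj V r v w} = ch v \<union> (if v = \<rho> then {} else {par v})"
  using assms by (auto simp: adj_iff ch_def pth_par)

lemma par_notin_ch:
  assumes "v \<in> V" "v \<noteq> \<rho>"
  shows "par v \<notin> ch v"
proof
  assume "par v \<in> ch v"
  with length_pth[of v] length_pth[of "par v"] show False
    using assms by (auto simp: ch_def)
qed

lemma finite_ch: "v \<in> V \<Longrightarrow> finite (ch v)"
  using locally_finite[of v] by (rule finite_subset[rotated]) (auto simp: adj_iff)

lemma len_pos: "v \<in> V \<Longrightarrow> v \<noteq> \<rho> \<Longrightarrow> len v > 0"
  using pth_par(2) by (auto simp: adj_def len_def)

section \<open>Heights and sums over the edges towards the root\<close>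

lemma ht_root [simp]: "ht \<rho> = 0"
  using pth_root unfolding pth_def by (simp add: tree_dist_def)

lemma ht_step:
  assumes "v \<in> V" "v \<noteq> \<rho>"
  shows "ht v = ht (par v) + len v"
proof -
  obtain q where q: "pth (par v) = par v # q"
    using pth[OF pth_par(1)[OF assms]] by (cases "pth (par v)") (auto simp: self_avoiding_path_def)
  have "ht v = (\<Sum>i<length (pth v) - 1. r {pth v ! i, pth v ! Suc i})" for v
    by (simp add: tree_dist_def pth_def Let_def)
  then show ?thesis
    using pth_par(3)[OF assms] by (simp add: q sum.lessThan_Suc_shift len_def del: sum.lessThan_Suc)
qed

lemma ht_nonneg: "v \<in> V \<Longrightarrow> ht v \<ge> 0"
  by (induction rule: tree_induct) (auto simp: ht_step dest: len_pos)

lemma ed_root [simp]: "ed \<rho> = {}"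
  by (simp add: ed_def)

lemma ed_step:
  assumes "v \<in> V" "v \<noteq> \<rho>"
  shows "ed v = insert v (ed (par v))" "v \<notin> ed (par v)"
  using pth_par(3)[OF assms] distinct_pth[OF assms(1)] assms by (auto simp: ed_def)

lemma finite_ed [simp]: "finite (ed v)"
  by (simp add: ed_def)

lemma ed_subset: "v \<in> V \<Longrightarrow> ed v \<subseteq> V - {\<rho>}"
  using pth_subset by (auto simp: ed_def)

lemma sum_ed_telescope: "v \<in> V \<Longrightarrow> (\<Sum>u\<in>ed v. F u - F (par u)) = F v - (F \<rho> :: real)"
  by (induction rule: tree_induct) (auto simp: ed_step)

lemma sum_ed_mono:
  fixes F :: "'v \<Rightarrow> real"
  assumes "v \<in> V" "u \<in> set (pth v)" and "\<And>u. u \<in> V \<Longrightarrow> u \<noteq> \<rho> \<Longrightarrow> F u \<ge> 0"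
  shows "sum F (ed u) \<le> sum F (ed v)"
  using assms(1,2)
proof (induction rule: tree_induct)
  case (step v)
  show ?case
  proof (cases "u = v")
    case False
    then have "sum F (ed u) \<le> sum F (ed (par v))" using step pth_par(3)[of v] by auto
    also have "\<dots> \<le> sum F (ed v)" using step assms(3)[of v] by (simp add: ed_step)
    finally show ?thesis .
  qed simp
qed simp

lemma ht_eq_sum: "v \<in> V \<Longrightarrow> ht v = sum len (ed v)"
  by (induction rule: tree_induct) (auto simp: ed_step ht_step)

lemma ht_mono: "v \<in> V \<Longrightarrow> u \<in> set (pth v) \<Longrightarrow> ht u \<le> ht v"
  using sum_ed_mono[of v u len] pth_subset[of v] len_pos
  by (subst (1 2) ht_eq_sum) (auto simp: less_imp_le)

text \<open>From any point of \<open>S\<close> the root is reached by climbing, and from the root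
  every vertex by descending.\<close>

lemma connected:
  assumes "S \<subseteq> V" "b \<in> S" "\<And>v w. v \<in> S \<Longrightarrow> adj V r v w \<Longrightarrow> w \<in> S"
  shows "S = V"
proof -
  have up: "v \<in> S \<Longrightarrow> \<rho> \<in> S" if "v \<in> V" for v
    using that
  proof (induction rule: tree_induct)
    case (step v)
    show ?case by (rule step(4)) (rule assms(3)[OF step(5) pth_par(2)[OF step(1,2)]])
  qed
  then have "\<rho> \<in> S" using assms by auto
  have "v \<in> S" if "v \<in> V" for v
    using that
  proof (induction rule: tree_induct)
    case root
    show ?case by fact
  next
    case (step v)
    have "adj V r (par v) v" using pth_par(2)[OF step(1,2)] adj_sym[of v] by simp
    then show ?case by (rule assms(3)[OF step(4)])
  qed
  then show ?thesis using assms by auto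
qed

section \<open>Directions\<close>

abbreviation dirs :: "(nat \<Rightarrow> 'v) set" where
  "dirs \<equiv> directions V r \<rho>"

text \<open>A direction cannot turn back: once \<open>x n\<close> is the parent of
  \<open>x (Suc n)\<close>, injectivity leaves only children for the next vertex.\<close>

lemma dirD:
  assumes "x \<in> dirs"
  shows "x n \<in> V" "x 0 = \<rho>" "x (Suc n) \<noteq> \<rho>" "par (x (Suc n)) = x n"
proof -
  have x: "x 0 = \<rho>" "inj x" "\<And>n. adj V r (x n) (x (Suc n))"
    using assms by (auto simp: directions_def)
  show "x n \<in> V" "x 0 = \<rho>" using x by (auto simp: adj_def)
  show "x (Suc n) \<noteq> \<rho>" for n using x(1,2) by (metis injD nat.distinct(1))
  show "par (x (Suc n)) = x n"
  proof (induction n)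
    case 0
    then show ?case using adj_cases[OF x(3)[of 0]] x(1) by (auto simp: ch_def)
  next
    case (Suc n)
    then show ?case using adj_cases[OF x(3)[of "Suc n"]] injD[OF x(2), of n "Suc (Suc n)"]
      by (auto simp: ch_def)
  qed
qed

text \<open>Each step lengthens \<open>pth\<close> by one, which yields injectivity.\<close>

lemma dirI:
  assumes "x 0 = \<rho>" "\<And>n. x (Suc n) \<in> ch (x n)"
  shows "x \<in> dirs"
proof -
  have V: "x n \<in> V" for n using assms root_in_V by (cases n) (auto simp: ch_def)
  have len: "length (pth (x n)) = Suc n" for n
    using assms by (induction n) (auto simp: length_pth ch_def)
  then have "inj x" by (metis injI nat.inject)
  then show ?thesis using assms by (auto simp: directions_def adj_iff)
qed

lemma dir_pth: "x \<in> dirs \<Longrightarrow> set (pth (x n)) = x ` {..n}"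
proof (induction n)
  case (Suc n)
  then show ?case using dirD[OF Suc.prems] pth_par(3)[of "x (Suc n)"]
    by (simp add: atMost_Suc)
qed (simp add: dirD)

lemma dir_length: "x \<in> dirs \<Longrightarrow> length (pth (x n)) = Suc n"
  by (induction n) (auto simp: length_pth dirD)

text \<open>A vertex determines its parent, so the indices of agreement form an initial segment;
  this is what makes \<open>branch_index\<close> a genuine branching point.\<close>

lemma dir_eq_below: "x \<in> dirs \<Longrightarrow> y \<in> dirs \<Longrightarrow> x k = y k \<Longrightarrow> j \<le> k \<Longrightarrow> x j = y j"
proof (induction k)
  case (Suc k)
  then show ?case using dirD(4)[of x k] dirD(4)[of y k] by (metis le_Suc_eq)
qed simp

lemma dir_ht: "x \<in> dirs \<Longrightarrow> ht (x n) = (\<Sum>i<n. r {x i, x (Suc i)})"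
  by (induction n) (auto simp: dirD ht_step len_def insert_commute)

lemma dir_ht_mono: "x \<in> dirs \<Longrightarrow> m \<le> n \<Longrightarrow> ht (x m) \<le> ht (x n)"
  by (intro ht_mono) (auto simp: dir_pth dirD)

lemma branch_index_cases:
  assumes "x \<in> dirs" "y \<in> dirs"
  obtains "branch_index x y = \<infinity>" "x = y"
    | k where "branch_index x y = enat k" "x k = y k" "\<And>n. x n = y n \<longleftrightarrow> n \<le> k"
proof (cases "x = y")
  case True
  have "branch_index x y = \<infinity>"
  proof (rule ccontr)
    assume "branch_index x y \<noteq> \<infinity>"
    then obtain k where k: "branch_index x y = enat k" by auto
    have "enat (Suc k) \<le> branch_index x y"
      unfolding branch_index_def using True by (intro Sup_upper) auto
    then show False by (simp add: k)
  qed
  then show ?thesis using True by (rule that(1))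
next
  case False
  then obtain n where n: "x n \<noteq> y n" by blast
  let ?S = "{k. x k = y k}"
  have lt: "k < n" if "k \<in> ?S" for k
  proof (rule ccontr)
    assume "\<not> k < n"
    then have "x n = y n" using that dir_eq_below[OF assms, of k n] by simp
    with n show False by blast
  qed
  then have "?S \<subseteq> {..<n}" by blast
  then have fin: "finite ?S" by (rule finite_subset) simp
  have "x 0 = y 0" using dirD(2)[OF assms(1)] dirD(2)[OF assms(2)] by simp
  then have ne: "?S \<noteq> {}" by blast
  let ?k = "Max ?S"
  have k: "x ?k = y ?k" using Max_in[OF fin ne] by (rule CollectD)
  have iff: "x j = y j \<longleftrightarrow> j \<le> ?k" for j
  proof
    assume "x j = y j"
    then have "j \<in> ?S" by (rule CollectI)
    with fin show "j \<le> ?k" by (rule Max_ge)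
  qed (rule dir_eq_below[OF assms k])
  have "branch_index x y = enat ?k"
    unfolding branch_index_def
  proof (rule antisym)
    show "Sup {enat k |k. x k = y k} \<le> enat ?k"
    proof (rule Sup_least)
      fix e assume "e \<in> {enat k |k. x k = y k}"
      then obtain j where "e = enat j" "x j = y j" by blast
      then show "e \<le> enat ?k" using iff[of j] enat_ord_simps(1) by blast
    qed
    show "enat ?k \<le> Sup {enat k |k. x k = y k}"
      by (rule Sup_upper) (use k in blast)
  qed
  then show ?thesis using k iff by (rule that(2))
qed

section \<open>Two-sided bounds for the metric on directions\<close>

lemma dir_dist_le_1: "dir_dist V r \<rho> x y \<le> 1"
  by (auto simp: dir_dist_def Let_def split: enat.split)

lemma dir_dist_le:
  assumes "x \<in> dirs" "y \<in> dirs" "x n = y n" "ht (x n) > 0"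
  shows "dir_dist V r \<rho> x y \<le> inverse (ht (x n))"
  using assms(1,2)
proof (cases rule: branch_index_cases)
  case 1
  then show ?thesis using assms by (simp add: dir_dist_def)
next
  case (2 k)
  then have "ht (x n) \<le> ht (x k)" using assms dir_ht_mono by blast
  then have "inverse (ht (x k)) \<le> inverse (ht (x n))" "ht (x k) \<noteq> 0"
    using assms(4) by (auto intro: le_imp_inverse_le)
  then show ?thesis using 2(1) by (simp add: dir_dist_def Let_def)
qed

text \<open>The height condition is a product because height 0 occurs at the root, where the
  distance is 1 by convention and \<open>d \<le> 1\<close> takes over.\<close>

lemma dir_dist_ge:
  assumes "x \<in> dirs" "y \<in> dirs" "x n \<noteq> y n" "d \<le> 1"
    and d: "\<And>k. k < n \<Longrightarrow> ht (x k) * d \<le> 1"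
  shows "d \<le> dir_dist V r \<rho> x y"
  using assms(1,2)
proof (cases rule: branch_index_cases)
  case 1
  then show ?thesis using assms by simp
next
  case (2 k)
  then have "k < n" using assms(3) by (metis not_le)
  moreover have "ht (x k) \<ge> 0" using ht_nonneg dirD assms by blast
  moreover have "d \<le> inverse (ht (x k))" if "ht (x k) > 0"
    using d[OF \<open>k < n\<close>] that by (simp add: field_simps)
  ultimately show ?thesis using 2(1) \<open>d \<le> 1\<close>
    by (auto simp: dir_dist_def Let_def)
qed

text \<open>If infinitely many vertices were not cut off by \<open>W\<close>, local finiteness would
  allow an endless descent through vertices that have infinitely many of them beyond, and this
  direction would miss \<open>W\<close>.\<close>

lemma konig:
  assumes "\<And>x. x \<in> dirs \<Longrightarrow> \<exists>n. x n \<in> W"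
  shows "finite {v \<in> V. set (pth v) \<inter> W = {}}"
proof (rule ccontr)
  define B where "B = {v \<in> V. set (pth v) \<inter> W = {}}"
  define D where "D v = {w \<in> B. v \<in> set (pth w)}" for v
  assume "infinite {v \<in> V. set (pth v) \<inter> W = {}}"
  then have "infinite B" by (simp add: B_def)
  have "D \<rho> = B" using root_in_pth by (auto simp: D_def B_def)
  have step: "\<exists>w. w \<in> ch v \<and> infinite (D w)" if v: "v \<in> V" "infinite (D v)" for v
  proof -
    have "w \<in> insert v (\<Union>u\<in>ch v. D u)" if "w \<in> D v" for w
    proof -
      have w: "w \<in> V" "w \<in> B" "v \<in> set (pth w)" using that by (auto simp: D_def B_def)
      have "w = v \<or> (\<exists>u\<in>ch v. u \<in> set (pth w))"
        using w(1,3)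
      proof (induction rule: tree_induct)
        case (step w)
        show ?case
        proof (cases "w = v \<or> par w = v")
          case True
          then show ?thesis using step self_in_pth[of w] by (auto simp: ch_def)
        next
          case False
          then show ?thesis using step pth_par(3)[of w] by auto
        qed
      qed simp
      then show ?thesis using w by (auto simp: D_def)
    qed
    then have "D v \<subseteq> insert v (\<Union>u\<in>ch v. D u)" by blast
    then have "infinite (\<Union>u\<in>ch v. D u)"
      using v finite_subset by blast
    then show ?thesis using finite_ch[OF v(1)] by auto
  qed
  define x where "x = rec_nat \<rho> (\<lambda>_ v. SOME w. w \<in> ch v \<and> infinite (D w))"
  have x0: "x 0 = \<rho>" and xS: "x (Suc n) = (SOME w. w \<in> ch (x n) \<and> infinite (D w))" for n
    by (auto simp: x_def)
  have inv: "x n \<in> V \<and> infinite (D (x n))" for n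
  proof (induction n)
    case 0
    then show ?case using x0 root_in_V \<open>D \<rho> = B\<close> \<open>infinite B\<close> by simp
  next
    case (Suc n)
    then show ?case using someI_ex[OF step[of "x n"]] xS[of n] by (auto simp: ch_def)
  qed
  have "x (Suc n) \<in> ch (x n)" for n
    using someI_ex[OF step[of "x n"]] xS[of n] inv[of n] by simp
  with x0 have "x \<in> dirs" by (intro dirI)
  then obtain n where n: "x n \<in> W" using assms by blast
  have "D (x n) \<noteq> {}" using inv[of n] by (metis finite.emptyI)
  then obtain w where "w \<in> D (x n)" by blast
  then show False using n by (auto simp: D_def B_def)
qed

section \<open>Energy and recurrence\<close>

text \<open>The loop at an isolated vertex mirrors \<open>transition_prob\<close>, so its row sums
  to 1 as well.\<close>

definition nbr :: "'v \<Rightarrow> 'v set" where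
  "nbr v = (if \<exists>z. adj V r v z then {z. adj V r v z} else {v})"

abbreviation total_conductance :: "'v \<Rightarrow> real" where
  "total_conductance v \<equiv> (\<Sum>z\<in>{z. adj V r v z}. conductance r v z)"

lemma conductance_pos: "adj V r v z \<Longrightarrow> conductance r v z > 0"
  by (simp add: adj_def conductance_def)

lemma total_conductance_pos:
  assumes "adj V r v z"
  shows "total_conductance v > 0"
  using assms by (intro sum_pos locally_finite) (auto simp: conductance_pos adj_def)

sublocale walk: finite_range_kernel V nbr "transition_prob V r"
proof
  fix v assume v: "v \<in> V"
  show "finite (nbr v)" using locally_finite[OF v] by (simp add: nbr_def)
  show "nbr v \<subseteq> V" using v by (auto simp: nbr_def adj_def)
  show "transition_prob V r v z > 0" if "z \<in> nbr v" for z
    using that total_conductance_pos[of v] conductance_pos[of v]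
    by (auto simp: nbr_def transition_prob_def split: if_splits)
  show "(\<Sum>z\<in>nbr v. transition_prob V r v z) = 1"
  proof (cases "\<exists>z. adj V r v z")
    case True
    then have "total_conductance v \<noteq> 0" using total_conductance_pos[of v] by force
    then show ?thesis using True by (simp add: nbr_def transition_prob_def flip: sum_divide_distrib)
  qed (simp add: nbr_def transition_prob_def)
qed

lemma nbr_connected: "S \<subseteq> V \<Longrightarrow> b \<in> S \<Longrightarrow> (\<And>v. v \<in> S \<Longrightarrow> nbr v \<subseteq> S) \<Longrightarrow> S = V"
  proof (rule connected)
  fix v w assume "\<And>v. v \<in> S \<Longrightarrow> nbr v \<subseteq> S" "v \<in> S" "adj V r v w"
  moreover have "w \<in> nbr v" using \<open>adj V r v w\<close> by (auto simp: nbr_def)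
  ultimately show "w \<in> S" by blast
qed

text \<open>The net current out of \<open>v\<close> when the network carries the potential \<open>g\<close>.\<close>

definition current :: "('v \<Rightarrow> real) \<Rightarrow> 'v \<Rightarrow> real" where
  "current g v = (\<Sum>w\<in>ch v. (g v - g w) / len w) + (if v = \<rho> then 0 else (g v - g (par v)) / len v)"

text \<open>Up to the total conductance, the current is the negative generator of the walk; this
  links network and chain.\<close>

lemma current_eq_generator:
  assumes v: "v \<in> V"
  shows "current g v = total_conductance v * (g v - (\<Sum>z\<in>nbr v. transition_prob V r v z * g z))"
proof -
  have c: "conductance r v w = inverse (len w)" if "w \<in> ch v" for w
    using chD[OF that] by (simp add: conductance_def len_def insert_commute)
  have "current g v = (\<Sum>z\<in>{z. adj V r v z}. conductance r v z * (g v - g z))"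
  proof (cases "v = \<rho>")
    case True
    then show ?thesis using neighbours[OF v] c
      by (simp add: current_def divide_inverse mult.commute)
  next
    case False
    then have "(\<Sum>z\<in>{z. adj V r v z}. conductance r v z * (g v - g z)) =
       conductance r v (par v) * (g v - g (par v)) + (\<Sum>z\<in>ch v. conductance r v z * (g v - g z))"
      using neighbours[OF v] par_notin_ch[OF v] finite_ch[OF v] by simp
    also have "(\<Sum>z\<in>ch v. conductance r v z * (g v - g z)) = (\<Sum>z\<in>ch v. (g v - g z) / len z)"
      by (intro sum.cong) (auto simp: c divide_inverse mult.commute)
    finally show ?thesis using False
      by (simp add: current_def divide_inverse mult.commute conductance_def len_def)
  qed
  also have "\<dots> = total_conductance v * (g v - (\<Sum>z\<in>nbr v. transition_prob V r v z * g z))"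
  proof (cases "\<exists>z. adj V r v z")
    case True
    then have "total_conductance v \<noteq> 0" using total_conductance_pos[of v] by force
    then show ?thesis using True
      by (simp add: nbr_def transition_prob_def right_diff_distrib sum_subtractf sum_distrib_left
          flip: sum_distrib_right)
  qed simp
  finally show ?thesis .
qed

lemma superharmonic_iff_current_nonneg:
  assumes v: "v \<in> V"
  shows "(\<Sum>z\<in>nbr v. transition_prob V r v z * g z) \<le> g v \<longleftrightarrow> 0 \<le> current g v"
proof (cases "\<exists>z. adj V r v z")
  case True
  then have "total_conductance v > 0" using total_conductance_pos by blast
  then show ?thesis by (simp add: current_eq_generator[OF v] zero_le_mult_iff)
next
  \<comment> \<open>Without neighbours the current is 0 and the mean is \<open>g v\<close> itself,
    so both sides hold.\<close>
  case False
  then show ?thesis by (simp add: current_eq_generator[OF v] nbr_def transition_prob_def)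
qed

text \<open>Discrete Green formula. \<open>A\<close> consists of the edges that meet
  \<open>S\<close>; endpoints outside \<open>S\<close> contribute nothing since \<open>k\<close>
  vanishes there.\<close>

lemma summation_by_parts:
  assumes S: "finite S" "S \<subseteq> V" and k: "\<And>v. v \<in> V \<Longrightarrow> v \<notin> S \<Longrightarrow> k v = 0"
    and A: "A = (S - {\<rho>}) \<union> (\<Union>v\<in>S. ch v)"
  shows "(\<Sum>v\<in>S. k v * current g v) = (\<Sum>w\<in>A. (g w - g (par w)) * (k w - k (par w)) / len w)"
proof -
  have fin: "finite A" using S finite_ch by (auto simp: A)
  have "A \<subseteq> V - {\<rho>}" using S(2) by (auto simp: A ch_def)
  then have AV: "w \<in> V" "w \<noteq> \<rho>" "par w \<in> V" if "w \<in> A" for w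
    using that pth_par(1)[of w] by auto
  have "(\<Sum>v\<in>S. k v * (\<Sum>w\<in>ch v. (g v - g w) / len w))
      = (\<Sum>v\<in>S. \<Sum>w\<in>ch v. k (par w) * (g (par w) - g w) / len w)"
    unfolding sum_distrib_left by (intro sum.cong refl) (simp add: ch_def)
  also have "\<dots> = (\<Sum>w\<in>(\<Union>v\<in>S. ch v). k (par w) * (g (par w) - g w) / len w)"
  proof (rule sum.UNION_disjoint[symmetric])
    show "\<forall>v\<in>S. finite (ch v)" using S finite_ch by blast
    show "\<forall>v\<in>S. \<forall>w\<in>S. v \<noteq> w \<longrightarrow> ch v \<inter> ch w = {}" by (auto simp: ch_def)
  qed (rule S)
  also have "\<dots> = (\<Sum>w\<in>A. k (par w) * (g (par w) - g w) / len w)"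
  proof (rule sum.mono_neutral_left[OF fin])
    show "\<forall>w\<in>A - (\<Union>v\<in>S. ch v). k (par w) * (g (par w) - g w) / len w = 0"
    proof
      fix w assume w: "w \<in> A - (\<Union>v\<in>S. ch v)"
      then have "w \<in> ch (par w)" using AV by (simp add: ch_def)
      then have "par w \<notin> S" using w by blast
      then show "k (par w) * (g (par w) - g w) / len w = 0" using k AV w by simp
    qed
  qed (simp add: A)
  finally have 1: "(\<Sum>v\<in>S. k v * (\<Sum>w\<in>ch v. (g v - g w) / len w))
    = (\<Sum>w\<in>A. k (par w) * (g (par w) - g w) / len w)" .
  have "(\<Sum>v\<in>S. k v * (if v = \<rho> then 0 else (g v - g (par v)) / len v))
      = (\<Sum>v\<in>S - {\<rho>}. k v * (g v - g (par v)) / len v)"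
    using S by (intro sum.mono_neutral_cong_right) auto
  also have "\<dots> = (\<Sum>v\<in>A. k v * (g v - g (par v)) / len v)"
  proof (rule sum.mono_neutral_left[OF fin])
    show "\<forall>w\<in>A - (S - {\<rho>}). k w * (g w - g (par w)) / len w = 0"
      using k AV by auto
  qed (simp add: A)
  finally have 2: "(\<Sum>v\<in>S. k v * (if v = \<rho> then 0 else (g v - g (par v)) / len v))
    = (\<Sum>v\<in>A. k v * (g v - g (par v)) / len v)" .
  show ?thesis
    unfolding current_def distrib_left sum.distrib 1 2 unfolding sum.distrib[symmetric]
    by (intro sum.cong refl) (simp add: algebra_simps diff_divide_distrib add_divide_distrib)
qed

text \<open>It is applied to finite sets of edges: a bound uniform in \<open>A\<close> stands for a
  bound on the total energy.\<close>

definition energy :: "'v set \<Rightarrow> ('v \<Rightarrow> real) \<Rightarrow> real" where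
  "energy A \<phi> = (\<Sum>w\<in>A. (\<phi> w - \<phi> (par w))\<^sup>2 / len w)"

text \<open>Picone's inequality is applied to \<open>1 + P_v(hit x)\<close>: the shift keeps the superharmonic function
  away from \<open>0\<close> without any appeal to irreducibility.\<close>

lemma hit_lim_eq_1_if_small_energy:
  assumes x: "x \<in> V"
    and small: "\<And>\<eta>. \<eta> > 0 \<Longrightarrow> \<exists>\<phi>. finite {v \<in> V. \<phi> v \<noteq> 0} \<and> \<phi> x = 1 \<and>
      (\<forall>A. finite A \<longrightarrow> A \<subseteq> V - {\<rho>} \<longrightarrow> energy A \<phi> \<le> \<eta>)"
  shows "hit_lim nbr (transition_prob V r) x x = 1"
proof (cases "\<exists>z. adj V r x z")
  case False
  then show ?thesis
    by (subst walk.hit_lim_eq[OF x]) (simp add: nbr_def transition_prob_def)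
next
  case True
  define F where "F = hit_lim nbr (transition_prob V r) x"
  define g where "g v = 1 + (if v = x then 1 else F v)" for v
  let ?c = "total_conductance x"
  have c: "?c > 0" using True total_conductance_pos by blast
  have F: "0 \<le> F v" "F v \<le> 1" if "v \<in> V" for v
    using walk.hit_lim_nonneg walk.hit_lim_le_1 that by (auto simp: F_def)
  have g_pos: "g v > 0" if "v \<in> V" for v using F[OF that] by (simp add: g_def)
  \<comment> \<open>One step of the kernel turns \<open>g\<close> into \<open>1 + F\<close>, so
    \<open>g\<close> can fail to be harmonic only at \<open>x\<close>, with defect
    \<open>1 - F x\<close>.\<close>
  have Pg: "(\<Sum>z\<in>nbr v. transition_prob V r v z * g z) = 1 + F v" if "v \<in> V" for v
  proof -
    have "F v = (\<Sum>z\<in>nbr v. transition_prob V r v z * (if z = x then 1 else F z))"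
      unfolding F_def by (rule walk.hit_lim_eq[OF that])
    then show ?thesis unfolding g_def distrib_left sum.distrib
      using walk.p_sum[OF that] by simp
  qed
  have cur: "0 \<le> current g v" if "v \<in> V" for v
  proof -
    have "1 + F v \<le> g v" using F(2)[OF that] by (cases "v = x") (simp_all add: g_def)
    then show ?thesis using superharmonic_iff_current_nonneg[OF that, of g] Pg[OF that] by simp
  qed
  \<comment> \<open>The factor 1/2 is the test function at \<open>x\<close>, as
    \<open>\<phi> x = 1\<close> and \<open>g x = 2\<close>.\<close>
  have "?c * (1 - F x) / 2 \<le> \<eta>" if "\<eta> > 0" for \<eta>
  proof -
    obtain \<phi> where \<phi>: "finite {v \<in> V. \<phi> v \<noteq> 0}" "\<phi> x = 1"
      "\<And>A. finite A \<Longrightarrow> A \<subseteq> V - {\<rho>} \<Longrightarrow> energy A \<phi> \<le> \<eta>"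
      using small[OF \<open>\<eta> > 0\<close>] by blast
    define S where "S = {v \<in> V. \<phi> v \<noteq> 0}"
    define A where "A = (S - {\<rho>}) \<union> (\<Union>v\<in>S. ch v)"
    define k where "k v = (\<phi> v)\<^sup>2 / g v" for v
    have fin: "finite S" "S \<subseteq> V" using \<phi> by (auto simp: S_def)
    have A: "finite A" "A \<subseteq> V - {\<rho>}" using fin finite_ch by (auto simp: A_def ch_def)
    have "?c * (1 - F x) / 2 = k x * current g x"
    proof -
      have "g x = 2" by (simp add: g_def)
      then show ?thesis
        unfolding current_eq_generator[OF x] Pg[OF x] by (simp add: k_def \<phi>(2))
    qed
    also have "\<dots> \<le> (\<Sum>v\<in>S. k v * current g v)"
    proof (rule member_le_sum)
      show "x \<in> S" using \<phi>(2) x by (simp add: S_def)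
      show "0 \<le> k v * current g v" if "v \<in> S - {x}" for v
        using that fin(2) cur[of v] g_pos[of v] by (auto simp: k_def)
    qed (rule fin(1))
    also have "\<dots> = (\<Sum>w\<in>A. (g w - g (par w)) * (k w - k (par w)) / len w)"
      using fin by (intro summation_by_parts) (auto simp: A_def S_def k_def)
    also have "\<dots> \<le> energy A \<phi>"
      unfolding energy_def
    proof (intro sum_mono divide_right_mono)
      fix w assume "w \<in> A"
      then have w: "w \<in> V" "w \<noteq> \<rho>" using A by auto
      show "(g w - g (par w)) * (k w - k (par w)) \<le> (\<phi> w - \<phi> (par w))\<^sup>2"
        unfolding k_def using g_pos w pth_par(1) by (intro picone) auto
      show "0 \<le> len w" using len_pos[OF w] by simp
    qed
    also have "\<dots> \<le> \<eta>" using \<phi>(3) A by blast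
    finally show ?thesis .
  qed
  then have "?c * (1 - F x) / 2 \<le> 0" by (rule field_le_epsilon) simp
  then have "F x \<ge> 1" using c by (simp add: mult_le_0_iff)
  then show ?thesis using F[OF x] by (simp add: F_def)
qed

section \<open>Cut functions\<close>

text \<open>On each path to \<open>w \<in> W\<close> the function below decreases linearly from \<open>1\<close> to (at most) \<open>0\<close>
  between heights \<open>s\<close> and \<open>ht w\<close>. An edge shared by several such paths gets the
  \<open>\<ell>^2\<close>-combination of their slopes, which dominates each slope while its square is the sum of
  their squares.\<close>

lemma cut_function:
  assumes W: "finite W" "W \<subseteq> V" "\<And>w. w \<in> W \<Longrightarrow> s < ht w" and s: "s \<ge> 0"
  obtains \<psi> where "\<And>v. v \<in> V \<Longrightarrow> ht v \<le> s \<Longrightarrow> \<psi> v = 1"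
    and "\<And>v. v \<in> V \<Longrightarrow> set (pth v) \<inter> W \<noteq> {} \<Longrightarrow> \<psi> v = 0"
    and "\<And>A. finite A \<Longrightarrow> A \<subseteq> V - {\<rho>} \<Longrightarrow> energy A \<psi> \<le> (\<Sum>w\<in>W. 1 / (ht w - s))"
proof -
  \<comment> \<open>The part of the edge above height \<open>s\<close>; the maxima also treat an
    edge that straddles this height.\<close>
  define portion where "portion u = max (ht u) s - max (ht (par u)) s" for u
  define Q where "Q u = (\<Sum>w\<in>{w \<in> W. u \<in> ed w}. 1 / (ht w - s)\<^sup>2)" for u
  define drop where "drop u = portion u * sqrt (Q u)" for u
  \<comment> \<open>The drops along a path may add up to more than 1; truncation at 0 handles this
    without enlarging any increment.\<close>
  define \<psi> where "\<psi> v = max 0 (1 - sum drop (ed v))" for v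
  have portion: "0 \<le> portion u" "portion u \<le> len u" if "u \<in> V" "u \<noteq> \<rho>" for u
    using ht_step[OF that] len_pos[OF that] by (auto simp: portion_def)
  have Q_nonneg: "Q u \<ge> 0" for u unfolding Q_def by (intro sum_nonneg) auto
  have drop_nonneg: "0 \<le> drop u" if "u \<in> V" "u \<noteq> \<rho>" for u
    using portion[OF that] Q_nonneg by (simp add: drop_def)
  have sum_portion: "sum portion (ed v) = max (ht v) s - s" if "v \<in> V" for v
    unfolding portion_def using sum_ed_telescope[OF that, of "\<lambda>v. max (ht v) s"] s by simp
  show thesis
  proof
    fix v assume v: "v \<in> V" "ht v \<le> s"
    have "drop u = 0" if "u \<in> ed v" for u
    proof -
      have u: "u \<in> V" "u \<noteq> \<rho>" "u \<in> set (pth v)" using that ed_subset[OF v(1)] by (auto simp: ed_def)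
      have "ht u \<le> s" using ht_mono[OF v(1) u(3)] v by simp
      then show ?thesis using ht_step[OF u(1,2)] len_pos[OF u(1,2)]
        by (simp add: drop_def portion_def)
    qed
    then show "\<psi> v = 1" by (simp add: \<psi>_def)
  next
    fix v assume v: "v \<in> V" "set (pth v) \<inter> W \<noteq> {}"
    then obtain w where w: "w \<in> set (pth v)" "w \<in> W" by auto
    have wV: "w \<in> V" using W w by auto
    have "1 = sum portion (ed w) / (ht w - s)"
      using sum_portion[OF wV] W(3)[OF w(2)] by simp
    also have "\<dots> = (\<Sum>u\<in>ed w. portion u * (1 / (ht w - s)))"
      by (simp add: sum_divide_distrib)
    also have "\<dots> \<le> sum drop (ed w)"
      unfolding drop_def
    proof (intro sum_mono mult_left_mono)
      fix u assume u: "u \<in> ed w"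
      have "(1 / (ht w - s))\<^sup>2 \<le> Q u"
        unfolding Q_def power_one_over[symmetric]
        using W w u by (intro member_le_sum[of w _ "\<lambda>w. (1 / (ht w - s))\<^sup>2"]) auto
      then show "1 / (ht w - s) \<le> sqrt (Q u)" by (rule real_le_rsqrt)
      show "0 \<le> portion u" using u ed_subset[OF wV] by (intro portion) auto
    qed
    also have "\<dots> \<le> sum drop (ed v)" using v w drop_nonneg by (intro sum_ed_mono) auto
    finally show "\<psi> v = 0" by (simp add: \<psi>_def)
  next
    fix A assume A: "finite A" "A \<subseteq> V - {\<rho>}"
    have "energy A \<psi> \<le> (\<Sum>u\<in>A. portion u * Q u)"
      unfolding energy_def
    proof (intro sum_mono)
      fix u assume "u \<in> A"
      then have u: "u \<in> V" "u \<noteq> \<rho>" using A by auto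
      have "\<bar>\<psi> u - \<psi> (par u)\<bar> \<le> drop u"
        using ed_step[OF u] drop_nonneg[OF u] by (simp add: \<psi>_def)
      then have "(\<psi> u - \<psi> (par u))\<^sup>2 \<le> (drop u)\<^sup>2"
        using drop_nonneg[OF u] by (simp add: abs_le_square_iff[symmetric])
      also have "\<dots> = portion u * (portion u * Q u)"
        using Q_nonneg[of u] by (simp add: drop_def power_mult_distrib power2_eq_square)
      also have "\<dots> \<le> len u * (portion u * Q u)"
        using portion[OF u] Q_nonneg[of u] by (intro mult_right_mono) auto
      finally show "(\<psi> u - \<psi> (par u))\<^sup>2 / len u \<le> portion u * Q u"
        using len_pos[OF u] by (simp add: field_simps)
    qed
    also have "\<dots> = (\<Sum>u\<in>A. \<Sum>w\<in>W. if u \<in> ed w then portion u / (ht w - s)\<^sup>2 else 0)"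
      unfolding Q_def sum.inter_filter[OF W(1)] sum_distrib_left
      by (rule sum.cong[OF refl], rule sum.cong[OF refl]) simp
    \<comment> \<open>After the exchange, the portions along the path to \<open>w\<close> telescope
      to \<open>ht w - s\<close>, cancelling one factor of the square.\<close>
    also have "\<dots> = (\<Sum>w\<in>W. \<Sum>u\<in>A. if u \<in> ed w then portion u / (ht w - s)\<^sup>2 else 0)"
      by (rule sum.swap)
    also have "\<dots> \<le> (\<Sum>w\<in>W. 1 / (ht w - s))"
    proof (intro sum_mono)
      fix w assume w: "w \<in> W"
      then have wV: "w \<in> V" using W by auto
      have "(\<Sum>u\<in>A. if u \<in> ed w then portion u / (ht w - s)\<^sup>2 else 0)
          = (\<Sum>u\<in>A \<inter> ed w. portion u / (ht w - s)\<^sup>2)"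
        using A by (simp add: sum.inter_restrict)
      also have "\<dots> \<le> (\<Sum>u\<in>ed w. portion u / (ht w - s)\<^sup>2)"
        using ed_subset[OF wV] portion(1) by (intro sum_mono2) (auto intro!: divide_nonneg_nonneg)
      also have "\<dots> = (ht w - s) / (ht w - s)\<^sup>2"
        using sum_portion[OF wV] W(3)[OF w] by (simp flip: sum_divide_distrib)
      also have "\<dots> = 1 / (ht w - s)" by (simp add: power2_eq_square)
      finally show "(\<Sum>u\<in>A. if u \<in> ed w then portion u / (ht w - s)\<^sup>2 else 0) \<le> 1 / (ht w - s)" .
    qed
    finally show "energy A \<psi> \<le> (\<Sum>w\<in>W. 1 / (ht w - s))" .
  qed
qed

text \<open>Each new function is still 1 wherever the previous sum varies. No edge carries both
  gradients, so the mixed terms vanish and the energies add.\<close>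

lemma recurrent_if_cut_functions:
  assumes cut: "\<And>s. s \<ge> 0 \<Longrightarrow> \<exists>\<psi>. finite {v \<in> V. \<psi> v \<noteq> 0} \<and> (\<forall>v\<in>V. ht v \<le> s \<longrightarrow> \<psi> v = 1)
      \<and> (\<forall>A. finite A \<longrightarrow> A \<subseteq> V - {\<rho>} \<longrightarrow> energy A \<psi> \<le> C)"
    and x: "x \<in> V"
  shows "hit_lim nbr (transition_prob V r) x x = 1"
proof (rule hit_lim_eq_1_if_small_energy[OF x])
  have ex: "\<exists>\<phi>. finite {v \<in> V. \<phi> v \<noteq> 0} \<and> (\<forall>v\<in>V. ht v \<le> ht x \<longrightarrow> \<phi> v = real K)
      \<and> (\<forall>A. finite A \<longrightarrow> A \<subseteq> V - {\<rho>} \<longrightarrow> energy A \<phi> \<le> real K * C)" for K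
  proof (induction K)
    case 0
    show ?case by (intro exI[of _ "\<lambda>_. 0"]) (auto simp: energy_def)
  next
    case (Suc K)
    then obtain \<phi> where \<phi>: "finite {v \<in> V. \<phi> v \<noteq> 0}" "\<And>v. v \<in> V \<Longrightarrow> ht v \<le> ht x \<Longrightarrow> \<phi> v = real K"
      "\<And>A. finite A \<Longrightarrow> A \<subseteq> V - {\<rho>} \<Longrightarrow> energy A \<phi> \<le> real K * C" by blast
    define S where "S = {v \<in> V. \<phi> v \<noteq> 0}"
    \<comment> \<open>An edge \<open>w\<close> outside \<open>T\<close> has \<open>\<phi>\<close>
      zero at both ends. One inside \<open>T\<close> lies on the plateau of the next function, which
      reaches up to \<open>sum ht T\<close>, a crude bound for all heights in
      \<open>T\<close>.\<close>
    define T where "T = insert x (S \<union> (\<Union>v\<in>S. ch v))"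
    have T: "finite T" "T \<subseteq> V" using \<phi>(1) finite_ch x by (auto simp: T_def S_def ch_def)
    have le: "ht v \<le> sum ht T" if "v \<in> T" for v
      using T ht_nonneg that by (intro member_le_sum) auto
    have "0 \<le> sum ht T" using T(2) by (intro sum_nonneg ht_nonneg) auto
    from cut[OF this] obtain \<psi> where \<psi>: "finite {v \<in> V. \<psi> v \<noteq> 0}" "\<And>v. v \<in> V \<Longrightarrow> ht v \<le> sum ht T \<Longrightarrow> \<psi> v = 1"
      "\<And>A. finite A \<Longrightarrow> A \<subseteq> V - {\<rho>} \<Longrightarrow> energy A \<psi> \<le> C"
      by blast
    define f where "f v = \<phi> v + \<psi> v" for v
    have "finite {v \<in> V. f v \<noteq> 0}"
      by (rule finite_subset[OF _ finite_UnI[OF \<phi>(1) \<psi>(1)]]) (auto simp: f_def)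
    moreover have "f v = real (Suc K)" if "v \<in> V" "ht v \<le> ht x" for v
      using \<phi>(2)[OF that] \<psi>(2)[OF that(1)] that(2) le[of x] by (simp add: f_def T_def)
    moreover have "energy A f \<le> real (Suc K) * C" if A: "finite A" "A \<subseteq> V - {\<rho>}" for A
    proof -
      have "energy A f = energy A \<phi> + energy A \<psi>"
        unfolding energy_def sum.distrib[symmetric]
      proof (intro sum.cong refl)
        fix w assume "w \<in> A"
        then have w: "w \<in> V" "w \<noteq> \<rho>" "par w \<in> V" using A pth_par(1) by auto
        have "\<phi> w = \<phi> (par w) \<or> \<psi> w = \<psi> (par w)"
        proof (cases "w \<in> T")
          case True
          then have "ht w \<le> sum ht T" by (rule le)
          moreover have "ht (par w) \<le> ht w" using ht_step[OF w(1,2)] len_pos[OF w(1,2)] by simp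
          ultimately show ?thesis using \<psi>(2) w by auto
        next
          case False
          then have "\<phi> w = 0" "\<phi> (par w) = 0" using w by (auto simp: T_def S_def ch_def)
          then show ?thesis by simp
        qed
        then show "(f w - f (par w))\<^sup>2 / len w = (\<phi> w - \<phi> (par w))\<^sup>2 / len w + (\<psi> w - \<psi> (par w))\<^sup>2 / len w"
          by (auto simp: f_def)
      qed
      also have "\<dots> \<le> real K * C + C" using \<phi>(3) \<psi>(3) A by (intro add_mono) auto
      finally show ?thesis by (simp add: algebra_simps)
    qed
    ultimately show ?case by blast
  qed
  fix \<eta> :: real assume \<eta>: "\<eta> > 0"
  \<comment> \<open>The maximum with 0 forces \<open>K > 0\<close> even for \<open>C\<close> not
    positive.\<close>
  obtain K :: nat where "max C 0 < real K * \<eta>"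
    using reals_Archimedean3[OF \<eta>] by blast
  then have K: "K > 0" "C < real K * \<eta>" by (auto intro: Nat.gr0I)
  obtain \<phi> where \<phi>: "finite {v \<in> V. \<phi> v \<noteq> 0}" "\<And>v. v \<in> V \<Longrightarrow> ht v \<le> ht x \<Longrightarrow> \<phi> v = real K"
      "\<And>A. finite A \<Longrightarrow> A \<subseteq> V - {\<rho>} \<Longrightarrow> energy A \<phi> \<le> real K * C" using ex[of K] by blast
  have "energy A (\<lambda>v. \<phi> v / real K) \<le> \<eta>" if A: "finite A" "A \<subseteq> V - {\<rho>}" for A
  proof -
    have "energy A (\<lambda>v. \<phi> v / real K) = energy A \<phi> / (real K)\<^sup>2"
      unfolding energy_def sum_divide_distrib
      by (intro sum.cong refl) (simp add: power_divide flip: diff_divide_distrib)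
    also have "\<dots> \<le> real K * C / (real K)\<^sup>2"
      using \<phi>(3)[OF A] by (intro divide_right_mono) auto
    also have "\<dots> \<le> \<eta>" using K by (simp add: power2_eq_square field_simps)
    finally show ?thesis .
  qed
  then show "\<exists>\<phi>. finite {v \<in> V. \<phi> v \<noteq> 0} \<and> \<phi> x = 1 \<and>
      (\<forall>A. finite A \<longrightarrow> A \<subseteq> V - {\<rho>} \<longrightarrow> energy A \<phi> \<le> \<eta>)"
    using \<phi>(1) \<phi>(2)[OF x] K(1) by (intro exI[of _ "\<lambda>v. \<phi> v / real K"]) simp
qed

section \<open>Covers by cylinders\<close>

lemma dir_ht_unbounded:
  assumes x: "x \<in> dirs" and div: "(\<Sum>n. ennreal (r {x n, x (Suc n)})) = \<infinity>"
  shows "\<exists>n. ht (x n) > B"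
proof (rule ccontr)
  assume "\<not> ?thesis"
  then have le: "ht (x n) \<le> B" for n by (simp add: not_less)
  have pos: "0 \<le> r {x i, x (Suc i)}" for i using dirD(1)[OF x] nonneg by blast
  have "(\<Sum>n. ennreal (r {x n, x (Suc n)})) \<le> ennreal B"
  proof (rule suminf_le_const)
    fix n
    have "(\<Sum>i<n. ennreal (r {x i, x (Suc i)})) = ennreal (ht (x n))"
      by (simp add: dir_ht[OF x] sum_ennreal pos)
    then show "(\<Sum>i<n. ennreal (r {x i, x (Suc i)})) \<le> ennreal B"
      using le ennreal_leI by simp
  qed simp
  then show False using div by (simp add: top_unique)
qed

text \<open>Take the first vertex of height at least \<open>1 / t\<close> on one direction of
  \<open>E\<close>. A direction leaving earlier would branch off below that height, hence at
  distance at least \<open>t\<close>, more than the diameter. The gap \<open>d < t\<close> covers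
  diameter 0, for which no finite height \<open>1 / d\<close> exists.\<close>

lemma covering_vertex:
  assumes E: "E \<subseteq> dirs" "E \<noteq> {}" and d: "diam (dir_dist V r \<rho>) E \<le> ennreal d" "0 \<le> d" "d < t" "t \<le> 1"
    and div: "\<And>x. x \<in> dirs \<Longrightarrow> (\<Sum>n. ennreal (r {x n, x (Suc n)})) = \<infinity>"
  shows "\<exists>v\<in>V. 1 \<le> ht v * t \<and> (\<forall>y\<in>E. v \<in> range y)"
proof -
  obtain x where x: "x \<in> E" "x \<in> dirs" using E by blast
  obtain m where "ht (x m) > 1 / t" using dir_ht_unbounded[OF x(2) div[OF x(2)]] by blast
  then have "1 \<le> ht (x m) * t" using d by (simp add: field_simps)
  define n where "n = (LEAST n. 1 \<le> ht (x n) * t)"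
  have n: "1 \<le> ht (x n) * t" unfolding n_def by (rule LeastI) fact
  have below: "ht (x k) * t \<le> 1" if "k < n" for k
    using not_less_Least[OF that[unfolded n_def]] by simp
  have "x n \<in> range y" if y: "y \<in> E" for y
  proof -
    have "x n = y n"
    proof (rule ccontr)
      assume "x n \<noteq> y n"
      then have "t \<le> dir_dist V r \<rho> x y"
        using E y x d below by (intro dir_dist_ge[of x y n]) auto
      moreover have "ennreal (dir_dist V r \<rho> x y) \<le> diam (dir_dist V r \<rho>) E"
        unfolding diam_def using x(1) y by (intro SUP_upper2[of x] SUP_upper2[of y]) auto
      then have "ennreal (dir_dist V r \<rho> x y) \<le> ennreal d" using d(1) by (rule order_trans)
      then have "dir_dist V r \<rho> x y \<le> d" using d(2) by (simp add: ennreal_le_iff)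
      ultimately show False using d by simp
    qed
    then show ?thesis by simp
  qed
  then show ?thesis using n dirD(1)[OF x(2)] by (intro bexI[of _ "x n"]) auto
qed

lemma cutset_of_bounded_cost:
  assumes H: "hausdorff_measure dirs (dir_dist V r \<rho>) 1 dirs = ennreal h" "h \<ge> 0" and s: "s \<ge> 0"
    and div: "\<And>x. x \<in> dirs \<Longrightarrow> (\<Sum>n. ennreal (r {x n, x (Suc n)})) = \<infinity>"
  obtains W where "W \<subseteq> V" "\<And>w. w \<in> W \<Longrightarrow> 2 * (s + 1) \<le> ht w"
    "\<And>x. x \<in> dirs \<Longrightarrow> \<exists>n. x n \<in> W"
    "\<And>F. finite F \<Longrightarrow> F \<subseteq> W \<Longrightarrow> (\<Sum>w\<in>F. 1 / ht w) \<le> h + 2"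
proof -
  let ?D = "dir_dist V r \<rho>"
  \<comment> \<open>Makes \<open>t i\<close> at most \<open>1 / (2 * (s + 1))\<close>, which turns
    into the height bound and also gives \<open>t i \<le> 1\<close>.\<close>
  define \<epsilon> where "\<epsilon> = 1 / (4 * (s + 1))"
  have \<epsilon>: "\<epsilon> > 0" "\<epsilon> \<le> 1 / 4" using s by (auto simp: \<epsilon>_def field_simps)
  have "hausdorff_content dirs ?D 1 dirs \<epsilon> \<le> ennreal h"
    unfolding H(1)[symmetric] hausdorff_measure_eq_SUP using \<epsilon> by (intro SUP_upper) auto
  also have "\<dots> < ennreal (h + 1)" using H(2) by (simp add: ennreal_less_iff)
  finally obtain E where E: "\<And>i. E i \<subseteq> dirs" "\<And>i. diam ?D (E i) \<le> ennreal \<epsilon>" "dirs \<subseteq> (\<Union>i. E i)"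
      "(\<Sum>i. diam_power ?D 1 (E i)) < ennreal (h + 1)"
    by (rule hausdorff_content_lessE) blast
  define d where "d i = enn2real (diam ?D (E i))" for i
  \<comment> \<open>The excess keeps \<open>t i\<close> positive for sets of diameter 0; all
    excesses together are at most \<open>\<epsilon>\<close>.\<close>
  define t where "t i = d i + \<epsilon> * (1 / 2) ^ Suc i" for i
  define I where "I = {i. E i \<noteq> {}}"
  have diam: "diam ?D (E i) = ennreal (d i)" for i
    unfolding d_def by (rule diam_finite_eq[OF E(2)])
  have d: "0 \<le> d i" "d i \<le> \<epsilon>" for i
  proof -
    show "0 \<le> d i" by (simp add: d_def)
    show "d i \<le> \<epsilon>" using E(2)[of i] \<epsilon> unfolding diam by (simp add: ennreal_le_iff)
  qed
  have t: "d i < t i" "t i \<le> 2 * \<epsilon>" for i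
  proof -
    show "d i < t i" using \<epsilon> by (simp add: t_def)
    have "(1 / 2 :: real) ^ Suc i \<le> 1" by (rule power_le_one) auto
    then have "\<epsilon> * (1 / 2) ^ Suc i \<le> \<epsilon> * 1" using \<epsilon> by (intro mult_left_mono) auto
    then show "t i \<le> 2 * \<epsilon>" using d(2)[of i] by (simp add: t_def)
  qed
  have "\<forall>i\<in>I. \<exists>v. v \<in> V \<and> 1 \<le> ht v * t i \<and> (\<forall>y\<in>E i. v \<in> range y)"
  proof
    fix i assume "i \<in> I"
    then have ne: "E i \<noteq> {}" by (simp add: I_def)
    have le: "diam ?D (E i) \<le> ennreal (d i)" by (simp add: diam)
    have "t i \<le> 1" using t(2)[of i] \<epsilon> by simp
    from covering_vertex[OF E(1) ne le d(1) t(1) this div]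
    show "\<exists>v. v \<in> V \<and> 1 \<le> ht v * t i \<and> (\<forall>y\<in>E i. v \<in> range y)"
      unfolding Bex_def .
  qed
  from bchoice[OF this] obtain v where
    vI: "\<forall>i\<in>I. v i \<in> V \<and> 1 \<le> ht (v i) * t i \<and> (\<forall>y\<in>E i. v i \<in> range y)" ..
  have v: "v i \<in> V" "1 \<le> ht (v i) * t i" "\<And>y. y \<in> E i \<Longrightarrow> v i \<in> range y" if "i \<in> I" for i
    using bspec[OF vI that] by simp_all
  have tpos: "0 < t i" for i using d(1)[of i] t(1)[of i] by simp
  have vt: "1 / t i \<le> ht (v i)" "0 < ht (v i)" "1 / ht (v i) \<le> t i" if "i \<in> I" for i
  proof -
    show 1: "1 / t i \<le> ht (v i)" using v(2)[OF that] tpos[of i] by (simp add: field_simps)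
    have "0 < 1 / t i" using tpos[of i] by simp
    with 1 show "0 < ht (v i)" by linarith
    then show "1 / ht (v i) \<le> t i" using v(2)[OF that] by (simp add: field_simps)
  qed
  show thesis
  proof (rule that[of "v ` I"])
    show "v ` I \<subseteq> V" using v(1) by blast
    show "2 * (s + 1) \<le> ht w" if w: "w \<in> v ` I" for w
    proof -
      obtain i where i: "i \<in> I" "w = v i" using w by blast
      have "2 * (s + 1) = 1 / (2 * \<epsilon>)" using s by (simp add: \<epsilon>_def)
      also have "\<dots> \<le> 1 / t i" using t(2)[of i] tpos[of i] by (intro divide_left_mono) auto
      also have "\<dots> \<le> ht w" using vt(1)[OF i(1)] i(2) by simp
      finally show ?thesis .
    qed
    show "\<exists>n. x n \<in> v ` I" if x: "x \<in> dirs" for x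
    proof -
      obtain i where i: "x \<in> E i" using E(3) x by blast
      then have "i \<in> I" by (auto simp: I_def)
      moreover from v(3)[OF this i] obtain n where "v i = x n" by blast
      ultimately have "x n \<in> v ` I" by (intro image_eqI[of _ _ i]) auto
      then show ?thesis ..
    qed
    \<comment> \<open>One unit of \<open>h + 2\<close> pays for the near-optimal cover, the other
      for the excesses. Finite subfamilies are summed since \<open>W\<close> may be
      infinite.\<close>
    show "(\<Sum>w\<in>F. 1 / ht w) \<le> h + 2" if F: "finite F" "F \<subseteq> v ` I" for F
    proof -
      obtain J where J: "J \<subseteq> I" "finite J" "F = v ` J"
        using finite_subset_image[OF F] by blast
      \<comment> \<open>Several covering sets may share a vertex, hence only an inequality.\<close>
      have "(\<Sum>w\<in>F. 1 / ht w) \<le> (\<Sum>i\<in>J. 1 / ht (v i))"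
      proof -
        have "0 \<le> 1 / ht (v i)" if "i \<in> J" for i using vt(2)[of i] that J(1) by auto
        from sum_image_le[OF J(2), of "\<lambda>w. 1 / ht w" v, OF this] show ?thesis by (simp add: J(3) o_def)
      qed
      also have "\<dots> \<le> sum t J" using vt(3) J(1) by (intro sum_mono) blast
      also have "\<dots> = sum d J + \<epsilon> * (\<Sum>i\<in>J. (1 / 2) ^ Suc i)"
        by (simp add: t_def sum.distrib sum_distrib_left)
      also have "sum d J \<le> h + 1"
      proof -
        have "diam_power ?D 1 (E i) = ennreal (d i)" if "i \<in> J" for i
        proof -
          have "E i \<noteq> {}" using that J(1) by (auto simp: I_def)
          then show ?thesis using d(1)[of i] unfolding diam_power_def d_def by simp
        qed
        then have "(\<Sum>i\<in>J. diam_power ?D 1 (E i)) = (\<Sum>i\<in>J. ennreal (d i))"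
          by (rule sum.cong[OF refl])
        also have "\<dots> = ennreal (sum d J)" using d(1) by (rule sum_ennreal)
        finally have "ennreal (sum d J) = (\<Sum>i\<in>J. diam_power ?D 1 (E i))" ..
        also have "\<dots> \<le> (\<Sum>i. diam_power ?D 1 (E i))" using J(2) by (intro sum_le_suminf) auto
        also have "\<dots> < ennreal (h + 1)" by (rule E)
        finally show ?thesis using d(1) by (simp add: ennreal_less_iff sum_nonneg)
      qed
      also have "\<epsilon> * (\<Sum>i\<in>J. (1 / 2) ^ Suc i) \<le> 1 * 1"
      proof (rule mult_mono)
        have "(\<Sum>i\<in>J. (1 / 2 :: real) ^ Suc i) \<le> (\<Sum>i. (1 / 2) ^ Suc i)"
          using J(2) power_half_series by (intro sum_le_suminf) (auto simp: sums_iff)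
        then show "(\<Sum>i\<in>J. (1 / 2 :: real) ^ Suc i) \<le> 1"
          using power_half_series by (simp add: sums_iff)
      qed (use \<epsilon> in \<open>auto intro: sum_nonneg\<close>)
      finally show ?thesis by simp
    qed
  qed
qed

lemma recurrent_if_finite_measure:
  assumes H: "hausdorff_measure dirs (dir_dist V r \<rho>) 1 dirs < \<infinity>"
    and div: "\<And>x. x \<in> dirs \<Longrightarrow> (\<Sum>n. ennreal (r {x n, x (Suc n)})) = \<infinity>"
    and x: "x \<in> V"
  shows "hit_lim nbr (transition_prob V r) x x = 1"
proof -
  obtain h where h: "hausdorff_measure dirs (dir_dist V r \<rho>) 1 dirs = ennreal h" "h \<ge> 0"
    using H by (cases "hausdorff_measure dirs (dir_dist V r \<rho>) 1 dirs") auto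
  show ?thesis
  proof (rule recurrent_if_cut_functions[OF _ x])
    fix s :: real assume s: "s \<ge> 0"
    obtain W where W: "W \<subseteq> V" "\<And>w. w \<in> W \<Longrightarrow> 2 * (s + 1) \<le> ht w"
      "\<And>x. x \<in> dirs \<Longrightarrow> \<exists>n. x n \<in> W"
      "\<And>F. finite F \<Longrightarrow> F \<subseteq> W \<Longrightarrow> (\<Sum>w\<in>F. 1 / ht w) \<le> h + 2"
      using cutset_of_bounded_cost[OF h s div] by blast
    define B where "B = {v \<in> V. set (pth v) \<inter> W = {}}"
    have B: "finite B" "B \<subseteq> V" using konig[OF W(3)] by (auto simp: B_def)
    \<comment> \<open>The vertices of \<open>W\<close> that come first on their path from the root;
      as children of the finite set \<open>B\<close> they are finite in number.\<close>
    define F where "F = {w \<in> W. w \<noteq> \<rho> \<and> par w \<in> B}"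
    have "F \<subseteq> (\<Union>v\<in>B. ch v)" using W(1) by (auto simp: F_def ch_def)
    moreover have "finite (\<Union>v\<in>B. ch v)" using B finite_ch by blast
    ultimately have F: "finite F" "F \<subseteq> W" by (auto simp: F_def intro: finite_subset)
    have "\<rho> \<notin> W" using W(2)[of \<rho>] s by auto
    have meet: "v \<in> B \<or> set (pth v) \<inter> F \<noteq> {}" if "v \<in> V" for v
      using that
    proof (induction rule: tree_induct)
      case root
      then show ?case using \<open>\<rho> \<notin> W\<close> root_in_V by (simp add: B_def)
    next
      case (step v)
      show ?case
      proof (cases "par v \<in> B")
        case True
        then show ?thesis using step pth_par(3)[of v] by (auto simp: B_def F_def)
      next
        case False
        then show ?thesis using step pth_par(3)[of v] by auto
      qed
    qed
    have lt: "s < ht w" if "w \<in> F" for w using W(2)[of w] F s that by auto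
    obtain \<psi> where \<psi>: "\<And>v. v \<in> V \<Longrightarrow> ht v \<le> s \<Longrightarrow> \<psi> v = 1"
      "\<And>v. v \<in> V \<Longrightarrow> set (pth v) \<inter> F \<noteq> {} \<Longrightarrow> \<psi> v = 0"
      "\<And>A. finite A \<Longrightarrow> A \<subseteq> V - {\<rho>} \<Longrightarrow> energy A \<psi> \<le> (\<Sum>w\<in>F. 1 / (ht w - s))"
      by (rule cut_function[OF F(1) _ lt s]) (use F W in blast)+
    \<comment> \<open>From \<open>2 * s \<le> ht w\<close> one gets
      \<open>ht w - s \<ge> ht w / 2\<close>.\<close>
    have "(\<Sum>w\<in>F. 1 / (ht w - s)) \<le> (\<Sum>w\<in>F. 2 * (1 / ht w))"
    proof (intro sum_mono)
      fix w assume "w \<in> F"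
      then have "2 * (s + 1) \<le> ht w" using W(2) F by blast
      then show "1 / (ht w - s) \<le> 2 * (1 / ht w)" using s by (simp add: field_simps)
    qed
    also have "\<dots> \<le> 2 * (h + 2)"
      using W(4)[OF F] unfolding sum_distrib_left[symmetric] by (rule mult_left_mono) simp
    finally have C: "(\<Sum>w\<in>F. 1 / (ht w - s)) \<le> 2 * (h + 2)" .
    have "{v \<in> V. \<psi> v \<noteq> 0} \<subseteq> B" using meet \<psi>(2) by blast
    then have "finite {v \<in> V. \<psi> v \<noteq> 0}" using B(1) by (rule finite_subset)
    moreover have "energy A \<psi> \<le> 2 * (h + 2)" if "finite A" "A \<subseteq> V - {\<rho>}" for A
      using \<psi>(3)[OF that] C by simp
    ultimately show "\<exists>\<psi>. finite {v \<in> V. \<psi> v \<noteq> 0} \<and> (\<forall>v\<in>V. ht v \<le> s \<longrightarrow> \<psi> v = 1) \<and>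
      (\<forall>A. finite A \<longrightarrow> A \<subseteq> V - {\<rho>} \<longrightarrow> energy A \<psi> \<le> 2 * (h + 2))"
      using \<psi>(1) by blast
  qed
qed

section \<open>Transience\<close>

definition cyl :: "'v \<Rightarrow> (nat \<Rightarrow> 'v) set" where
  "cyl v = {x \<in> dirs. v \<in> range x}"

lemma cyl_root: "cyl \<rho> = dirs"
proof -
  have "\<rho> \<in> range x" if "x \<in> dirs" for x
    using dirD(2)[OF that] by (intro range_eqI[of _ _ 0]) simp
  then show ?thesis by (auto simp: cyl_def)
qed

lemma cyl_subset_children: "cyl v \<subseteq> (\<Union>w\<in>ch v. cyl w)"
proof
  fix x assume "x \<in> cyl v"
  then obtain n where x: "x \<in> dirs" "v = x n" by (auto simp: cyl_def)
  then have "x (Suc n) \<in> ch v" using dirD[OF x(1)] by (auto simp: ch_def)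
  moreover have "x \<in> cyl (x (Suc n))" using x by (auto simp: cyl_def)
  ultimately show "x \<in> (\<Union>w\<in>ch v. cyl w)" by blast
qed

text \<open>\<open>2 / (1 + h)\<close> dominates the minimum of 1 and \<open>1 / h\<close> and stays
  finite at the root. Directions through \<open>v\<close> pass it at the same index, its
  depth.\<close>

lemma diam_cyl_le:
  assumes "v \<in> V"
  shows "diam (dir_dist V r \<rho>) (cyl v) \<le> ennreal (2 / (1 + ht v))"
  unfolding diam_def
proof (intro SUP_least ennreal_leI)
  fix x y assume "x \<in> cyl v" "y \<in> cyl v"
  then obtain n m where xy: "x \<in> dirs" "y \<in> dirs" "x n = v" "y m = v" by (auto simp: cyl_def)
  then have nm: "n = m" using dir_length[OF xy(1), of n] dir_length[OF xy(2), of m] by simp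
  note ht = ht_nonneg[OF assms]
  show "dir_dist V r \<rho> x y \<le> 2 / (1 + ht v)"
  proof (cases "ht v \<le> 1")
    case True
    then have "1 \<le> 2 / (1 + ht v)" using ht by (simp add: field_simps)
    with dir_dist_le_1[of x y] show ?thesis by simp
  next
    case False
    then have "dir_dist V r \<rho> x y \<le> inverse (ht v)"
      using dir_dist_le[of x y n] xy nm by simp
    also have "\<dots> \<le> 2 / (1 + ht v)" using False by (simp add: field_simps)
    finally show ?thesis .
  qed
qed

text \<open>Under recurrence the nonnegative superharmonic function \<open>M - f\<close> is
  constant. Then \<open>q\<close> vanishes on the children of the root, by subadditivity at the
  root, and the measure of all directions is 0.\<close>

lemma transient_if_positive_measure:
  assumes \<alpha>: "\<alpha> > 1" and H: "hausdorff_measure dirs (dir_dist V r \<rho>) \<alpha> dirs \<noteq> 0" and x: "x \<in> V"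
  shows "hit_lim nbr (transition_prob V r) x x < 1"
proof (rule ccontr)
  assume "\<not> ?thesis"
  then have rec: "hit_lim nbr (transition_prob V r) x x = 1"
    using walk.hit_lim_le_1[OF x, of x] by simp
  let ?D = "dir_dist V r \<rho>"
  \<comment> \<open>Scale 1 does not restrict covers, since all distances are at most 1; in
    particular a cylinder covers itself.\<close>
  define c where "c v = hausdorff_content dirs ?D \<alpha> (cyl v) 1" for v
  define q where "q v = enn2real (c v)" for v
  have c_le: "c v \<le> ennreal (2 powr \<alpha> * (1 + ht v) powr (- \<alpha>))" if v: "v \<in> V" for v
  proof -
    have "diam ?D (cyl v) \<le> ennreal 1"
      unfolding diam_def by (intro SUP_least ennreal_leI dir_dist_le_1)
    then have "c v \<le> diam_power ?D \<alpha> (cyl v)"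
      unfolding c_def by (intro hausdorff_content_le_diam_power) (auto simp: cyl_def)
    also have "\<dots> \<le> ennreal (enn2real (diam ?D (cyl v)) powr \<alpha>)"
      using \<alpha> by (simp add: diam_power_def)
    also have "enn2real (diam ?D (cyl v)) powr \<alpha> \<le> (2 / (1 + ht v)) powr \<alpha>"
      using \<alpha> diam_cyl_le[OF v] ht_nonneg[OF v] by (intro powr_mono2 enn2real_leI) auto
    also have "\<dots> = 2 powr \<alpha> * (1 + ht v) powr (- \<alpha>)"
      using ht_nonneg[OF v] by (simp add: powr_divide powr_minus_divide)
    finally show ?thesis by (simp add: ennreal_leI)
  qed
  have q_nonneg: "0 \<le> q v" for v by (simp add: q_def)
  have q_le: "q v \<le> 2 powr \<alpha> * (1 + ht v) powr (- \<alpha>)" if "v \<in> V" for v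
    unfolding q_def using c_le[OF that] by (intro enn2real_leI) auto
  have c_eq: "c v = ennreal (q v)" if "v \<in> V" for v
    unfolding q_def using le_less_trans[OF c_le[OF that] ennreal_less_top] by simp
  have q_sub: "q v \<le> (\<Sum>w\<in>ch v. q w)" if v: "v \<in> V" for v
  proof -
    have "c v \<le> hausdorff_content dirs ?D \<alpha> (\<Union>w\<in>ch v. cyl w) 1"
      unfolding c_def by (rule hausdorff_content_mono[OF cyl_subset_children])
    also have "\<dots> \<le> (\<Sum>w\<in>ch v. c w)"
      unfolding c_def by (rule hausdorff_content_UN[OF finite_ch[OF v]])
    also have "\<dots> = (\<Sum>w\<in>ch v. ennreal (q w))"
      by (rule sum.cong[OF refl]) (simp add: c_eq ch_def)
    also have "\<dots> = ennreal (\<Sum>w\<in>ch v. q w)"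
      by (rule sum_ennreal) (rule q_nonneg)
    finally show ?thesis
      unfolding q_def[of v] by (intro enn2real_leI sum_nonneg q_nonneg)
  qed
  \<comment> \<open>Ohm's law: flow times resistance, summed along the path to the root.\<close>
  define f where "f v = (\<Sum>u\<in>ed v. len u * q u)" for v
  \<comment> \<open>\<open>2 powr \<alpha>\<close> times the integral of
    \<open>t powr - \<alpha>\<close> over t \<ge> 1, finite because
    \<open>\<alpha> > 1\<close>.\<close>
  define M where "M = 2 powr \<alpha> / (\<alpha> - 1)"
  have f_step: "f w = f (par w) + len w * q w" if "w \<in> V" "w \<noteq> \<rho>" for w
    using ed_step[OF that] by (simp add: f_def)
  have f_le: "f v \<le> M" if v: "v \<in> V" for v
  proof -
    \<comment> \<open>As a function of the height, an antiderivative of the bound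
      \<open>q_le\<close>.\<close>
    define G where "G v = - M * (1 + ht v) powr (1 - \<alpha>)" for v
    have "f v \<le> (\<Sum>u\<in>ed v. G u - G (par u))"
      unfolding f_def
    proof (intro sum_mono)
      fix u assume "u \<in> ed v"
      then have u: "u \<in> V" "u \<noteq> \<rho>" using ed_subset[OF v] by auto
      let ?a = "1 + ht (par u)" and ?b = "1 + ht u"
      have ab: "0 < ?a" "?a \<le> ?b" "len u = ?b - ?a"
        using ht_nonneg[OF pth_par(1)[OF u]] ht_step[OF u] len_pos[OF u] by auto
      have "len u * q u \<le> len u * (2 powr \<alpha> * ?b powr (- \<alpha>))"
        using q_le[OF u(1)] len_pos[OF u] by (intro mult_left_mono) auto
      also have "\<dots> = 2 powr \<alpha> * ((?b - ?a) * ?b powr (- \<alpha>))"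
        using ab(3) by simp
      also have "\<dots> \<le> 2 powr \<alpha> * ((?a powr (1 - \<alpha>) - ?b powr (1 - \<alpha>)) / (\<alpha> - 1))"
        using ab \<alpha> by (intro mult_left_mono powr_increment_le) auto
      also have "\<dots> = G u - G (par u)"
        by (simp add: G_def M_def algebra_simps diff_divide_distrib)
      finally show "len u * q u \<le> G u - G (par u)" .
    qed
    also have "\<dots> = G v - G \<rho>" by (rule sum_ed_telescope[OF v])
    also have "\<dots> \<le> M" using \<alpha> by (simp add: G_def M_def)
    finally show ?thesis .
  qed
  have const: "M - f v = M - f x" if "v \<in> V" for v
  proof (rule walk.superharmonic_constant_if_recurrent[where u = "\<lambda>v. M - f v", OF nbr_connected rec x])
    fix v assume v: "v \<in> V"
    show "0 \<le> M - f v" using f_le[OF v] by simp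
    have ch: "(\<Sum>w\<in>ch v. ((M - f v) - (M - f w)) / len w) = (\<Sum>w\<in>ch v. q w)"
    proof (rule sum.cong[OF refl])
      fix w assume "w \<in> ch v"
      then have w: "w \<in> V" "w \<noteq> \<rho>" "par w = v" by (auto simp: ch_def)
      then show "((M - f v) - (M - f w)) / len w = q w"
        using f_step[OF w(1,2)] len_pos[OF w(1,2)] by simp
    qed
    have par: "(if v = \<rho> then 0 else ((M - f v) - (M - f (par v))) / len v) = (if v = \<rho> then 0 else - q v)"
      using f_step[OF v] len_pos[OF v] by (cases "v = \<rho>") simp_all
    \<comment> \<open>The current is the outflow to the children minus the inflow from the parent,
      nonnegative by \<open>q_sub\<close>.\<close>
    have "0 \<le> current (\<lambda>v. M - f v) v"
      unfolding current_def ch par using q_sub[OF v] q_nonneg by (simp add: sum_nonneg)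
    then show "(\<Sum>z\<in>nbr v. transition_prob V r v z * (M - f z)) \<le> M - f v"
      using superharmonic_iff_current_nonneg[OF v, of "\<lambda>v. M - f v"] by simp
  qed (use that in auto)
  have "q w = 0" if "w \<in> ch \<rho>" for w
  proof -
    have w: "w \<in> V" "w \<noteq> \<rho>" "par w = \<rho>" using that by (auto simp: ch_def)
    have "f w = f \<rho>" using const[OF w(1)] const[OF root_in_V] by simp
    then show ?thesis using f_step[OF w(1,2)] len_pos[OF w(1,2)] w(3) by simp
  qed
  then have "q \<rho> = 0" using q_sub[OF root_in_V] q_nonneg[of \<rho>] by simp
  then have "hausdorff_content dirs ?D \<alpha> dirs 1 = 0"
    using c_eq[OF root_in_V] by (simp add: c_def cyl_root)
  then have "hausdorff_measure dirs ?D \<alpha> dirs = 0"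
    using \<alpha> by (intro hausdorff_measure_eq_0_if_content_eq_0) auto
  with H show False by simp
qed

end

theorem theorem5:
  fixes V :: "'v set" and r :: "'v set \<Rightarrow> real" and \<rho> :: 'v
    and P :: "'v \<Rightarrow> 'w measure" and X :: "nat \<Rightarrow> 'w \<Rightarrow> 'v"
  assumes "weighted_discrete_tree V r"
    and "\<rho> \<in> V"
    and "\<And>x. x \<in> directions V r \<rho> \<Longrightarrow> (\<Sum>n. ennreal (r {x n, x (Suc n)})) = \<infinity>"
    and "random_walk V r P X"
  shows "(hausdorff_measure (directions V r \<rho>) (dir_dist V r \<rho>) 1 (directions V r \<rho>) < \<infinity>
            \<longrightarrow> recurrent V P X)
       \<and> (hausdorff_dim (directions V r \<rho>) (dir_dist V r \<rho>) (directions V r \<rho>) > 1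
            \<longrightarrow> transient V P X)"
proof -
  interpret rooted_weighted_tree V r \<rho>
    using assms(1,2) by (simp add: rooted_weighted_tree_def rooted_weighted_tree_axioms_def)
  \<comment> \<open>Recurrence and transience are both read off from this number, which does not
    depend on the realisation of the walk.\<close>
  have ret: "\<P>(\<omega> in P x. \<exists>n\<ge>1. X n \<omega> = x) = hit_lim nbr (transition_prob V r) x x" if "x \<in> V" for x
    using assms(4) that by (intro walk.return_probability_eq_hit_lim) (auto simp: random_walk_def)
  show ?thesis
  proof (intro conjI impI)
    assume "hausdorff_measure dirs (dir_dist V r \<rho>) 1 dirs < \<infinity>"
    from recurrent_if_finite_measure[OF this assms(3)] show "recurrent V P X"
      unfolding recurrent_def using ret by simp
  next
    assume "hausdorff_dim dirs (dir_dist V r \<rho>) dirs > 1"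
    then have "hausdorff_dim dirs (dir_dist V r \<rho>) dirs > ennreal 1" by simp
    then obtain \<alpha> where "\<alpha> > 1" "hausdorff_measure dirs (dir_dist V r \<rho>) \<alpha> dirs \<noteq> 0"
      by (rule hausdorff_measure_nonzero_if_less_dim) auto
    from transient_if_positive_measure[OF this] show "transient V P X"
      unfolding transient_def using ret by simp
  qed
qed

end
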